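(* Let $\kappa$ be a regular uncountable cardinal with $\kappa^{<\kappa}=\kappa$. If $\mathfrak{p}(\kappa)=2^\kappa$, then for any $\lambda<\kappa$ and any partition $\{O_\alpha \mid \alpha<\lambda\}$ of $\kappa$ there is a $\kappa$-maximal cofinitary group $G\leq S(\kappa)$ such that $\mathsf{ORB}(G)=\{O_\alpha \mid \alpha<\lambda\}$.
   Context: $S(\kappa)$ is the group of all permutations of $\kappa$. A permutation $f\in S(\kappa)$ is $\kappa$-cofinitary if it has fewer than $\kappa$ many fixed points. A subgroup $G\leq S(\kappa)$ is $\kappa$-cofinitary if all of its non-identity elements are $\kappa$-cofinitary. A $\kappa$-maximal cofinitary group is a $\kappa$-cofinitary group $G\leq S(\kappa)$ such that no proper supergroup of $G$ in $S(\kappa)$ is $\kappa$-cofinitary. For $G\leq S(\kappa)$, $\mathsf{ORB}(G)$ denotes the set of orbits of the natural action $(g,\alpha)\mapsto g(\alpha)$ of $G$ on $\kappa$. A family $\mathcal{F}$ of subsets of $\kappa$ has the strong intersection property if for any subfamily $\mathcal{F}'\subseteq\mathcal{F}$ of size ${<}\kappa$ the intersection $\bigcap\mathcal{F}'$ has size $\kappa$. For $B,C\in[\kappa]^\kappa$, $B$ is almost contained in $C$ if $|B\setminus C|<\kappa$. The pseudointersection number $\mathfrak{p}(\kappa)$ is the least size of a family $\mathcal{F}$ with the strong intersection property for which there is no $A\in[\kappa]^\kappa$ which is almost contained in all $F\in\mathcal{F}$. *)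

theory Defs
  imports
    "HOL-Algebra.Bij"
    "HOL-Algebra.Group_Action"
    "HOL-Library.Disjoint_Sets"
begin

unbundle cardinal_syntax

text \<open>
  A cardinal is a well-order \<open>\<kappa>\<close> with \<open>Card_order \<kappa>\<close>. The elements of
  \<open>Field \<kappa>\<close> play the role of the ordinals below \<open>\<kappa>\<close>, and
  \<open>underS \<kappa> \<alpha>\<close> is the set of ordinals below \<open>\<alpha>\<close>.
\<close>

text \<open>\<open>\<kappa>\<^sup><\<^sup>\<kappa>\<close>, the size of the set of all functions from some \<open>\<alpha> < \<kappa>\<close> to \<open>\<kappa>\<close>. The
  disjoint sum over \<open>\<alpha>\<close> keeps functions with different domains apart, because the
  functions in \<open>Func A B\<close> are total and merely \<open>undefined\<close> outside of \<open>A\<close>.\<close>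

definition less_power :: "'a rel \<Rightarrow> ('a \<times> ('a \<Rightarrow> 'a)) rel" where
  "less_power \<kappa> = |SIGMA \<alpha>:Field \<kappa>. Func (underS \<kappa> \<alpha>) (Field \<kappa>)|"

text \<open>The intersection with \<open>Field \<kappa>\<close> matters only for the empty subfamily, whose
  intersection would otherwise be \<open>UNIV\<close>.\<close>

definition strong_intersection_property :: "'a rel \<Rightarrow> 'a set set \<Rightarrow> bool" where
  "strong_intersection_property \<kappa> F \<longleftrightarrow>
     (\<forall>F'. F' \<subseteq> F \<and> |F'| <o \<kappa> \<longrightarrow> |Field \<kappa> \<inter> \<Inter>F'| =o \<kappa>)"

definition almost_contained :: "'a rel \<Rightarrow> 'a set \<Rightarrow> 'a set \<Rightarrow> bool" where
  "almost_contained \<kappa> B C \<longleftrightarrow> |B - C| <o \<kappa>"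

definition is_pseudointersection :: "'a rel \<Rightarrow> 'a set set \<Rightarrow> 'a set \<Rightarrow> bool" where
  "is_pseudointersection \<kappa> F A \<longleftrightarrow>
     A \<subseteq> Field \<kappa> \<and> |A| =o \<kappa> \<and> (\<forall>B\<in>F. almost_contained \<kappa> A B)"

definition no_pseudointersection_family :: "'a rel \<Rightarrow> 'a set set \<Rightarrow> bool" where
  "no_pseudointersection_family \<kappa> F \<longleftrightarrow>
     F \<subseteq> Pow (Field \<kappa>) \<and> strong_intersection_property \<kappa> F \<and>
     \<not> (\<exists>A. is_pseudointersection \<kappa> F A)"

text \<open>The choice picks a family of least size. Such families exist whenever \<open>\<kappa>\<close> is
  regular and uncountable, for example the closed unbounded sets.\<close>

definition pseudointersection_number :: "'a rel \<Rightarrow> 'a set rel" where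
  "pseudointersection_number \<kappa> =
     |SOME F. no_pseudointersection_family \<kappa> F \<and>
        (\<forall>F'. no_pseudointersection_family \<kappa> F' \<longrightarrow> |F| \<le>o |F'| )|"

lemma pseudointersection_number_least:
  assumes "no_pseudointersection_family \<kappa> F"
  shows "\<exists>F0. no_pseudointersection_family \<kappa> F0 \<and> pseudointersection_number \<kappa> = |F0|"
    and "pseudointersection_number \<kappa> \<le>o |F|"
proof -
  let ?Q = "\<lambda>F. no_pseudointersection_family \<kappa> F \<and>
        (\<forall>F'. no_pseudointersection_family \<kappa> F' \<longrightarrow> |F| \<le>o |F'| )"
  have "\<exists>r\<in>card_of ` Collect (no_pseudointersection_family \<kappa>).
          \<forall>r'\<in>card_of ` Collect (no_pseudointersection_family \<kappa>). r \<le>o r'"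
    using assms by (intro exists_minim_Card_order) (auto intro: card_of_Card_order)
  then have "\<exists>F. ?Q F" by auto
  then have Q: "?Q (SOME F. ?Q F)" by (rule someI_ex)
  then show "\<exists>F0. no_pseudointersection_family \<kappa> F0 \<and> pseudointersection_number \<kappa> = |F0|"
    unfolding pseudointersection_number_def by blast
  show "pseudointersection_number \<kappa> \<le>o |F|"
    using Q assms unfolding pseudointersection_number_def by blast
qed

definition cofinitary_perm :: "'a rel \<Rightarrow> ('a \<Rightarrow> 'a) \<Rightarrow> bool" where
  "cofinitary_perm \<kappa> f \<longleftrightarrow> |{x \<in> Field \<kappa>. f x = x}| <o \<kappa>"

definition cofinitary_group :: "'a rel \<Rightarrow> ('a \<Rightarrow> 'a) set \<Rightarrow> bool" where
  "cofinitary_group \<kappa> G \<longleftrightarrow>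
     subgroup G (BijGroup (Field \<kappa>)) \<and>
     (\<forall>g\<in>G. g \<noteq> \<one>\<^bsub>BijGroup (Field \<kappa>)\<^esub> \<longrightarrow> cofinitary_perm \<kappa> g)"

definition maximal_cofinitary_group :: "'a rel \<Rightarrow> ('a \<Rightarrow> 'a) set \<Rightarrow> bool" where
  "maximal_cofinitary_group \<kappa> G \<longleftrightarrow>
     cofinitary_group \<kappa> G \<and> \<not> (\<exists>H. G \<subset> H \<and> cofinitary_group \<kappa> H)"

definition ORB :: "'a rel \<Rightarrow> ('a \<Rightarrow> 'a) set \<Rightarrow> 'a set set" where
  "ORB \<kappa> G = orbits (BijGroup (Field \<kappa>)\<lparr>carrier := G\<rparr>) (Field \<kappa>) (\<lambda>g. g)"

end

theory Submission
  imports Defs "HOL-Algebra.Generated_Groups"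
begin

text \<open>
  From \<open>\<pp>(\<kappa>) = 2\<^sup>\<kappa>\<close> only the following is used: fewer than \<open>2\<^sup>\<kappa>\<close> many functions from \<open>\<kappa>\<close> to \<open>\<kappa>\<close>
  are dominated by a single function \<open>d\<close>. Let \<open>d\<close> dominate a cofinitary group \<open>G\<close> and let \<open>g\<close> be a
  permutation such that of the points \<open>x\<close> and \<open>g x\<close> the larger one always lies above the \<open>d\<close>-image of
  the smaller one, and such that these larger points are themselves spread out with respect to \<open>d\<close>.
  A fixed point of a cyclically reduced word in \<open>g\<close> and \<open>G\<close> yields a closed path; elements of \<open>G\<close> move
  points only within the range of \<open>d\<close>, so at the highest point of the path there is no way to
  continue. Hence \<open>\<langle>G, g\<rangle>\<close> is cofinitary. There is enough freedom in the choice of \<open>g\<close> to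
  prescribe it on a small set, and, given a permutation \<open>h\<close> that agrees with each element
  of \<open>G\<close> in fewer than \<open>\<kappa>\<close> points, to give \<open>h\<inverse> g h g\<close> \<open>\<kappa>\<close> many fixed points, so that \<open>h\<close> cannot be added later on.
  A recursion over all permutations \<open>h\<close> produces the maximal group; transpositions \<open>h\<close> within a block
  of the partition are used to make the group transitive on that block.
\<close>

section \<open>Words in a generated subgroup\<close>

text \<open>There is no coefficient in front of the first letter, since conjugation moves it behind
  the last one.\<close>

definition word_val :: "('a, 'b) monoid_scheme \<Rightarrow> 'a \<Rightarrow> (bool \<times> 'a) list \<Rightarrow> 'a" where
  "word_val G x w =
     foldr (\<lambda>(e, a) v. (if e then x else inv\<^bsub>G\<^esub> x) \<otimes>\<^bsub>G\<^esub> (a \<otimes>\<^bsub>G\<^esub> v)) w \<one>\<^bsub>G\<^esub>"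

text \<open>Taking the index modulo the length makes the first letter the successor of the last, so
  the condition is invariant under rotation. A word with one letter satisfies it
  automatically.\<close>

definition cyclically_reduced :: "('a, 'b) monoid_scheme \<Rightarrow> (bool \<times> 'a) list \<Rightarrow> bool" where
  "cyclically_reduced G w \<longleftrightarrow> (\<forall>i<length w.
     snd (w ! i) = \<one>\<^bsub>G\<^esub> \<longrightarrow> fst (w ! i) = fst (w ! (Suc i mod length w)))"

context group
begin

lemma word_val_Nil [simp]: "word_val G x [] = \<one>"
  by (simp add: word_val_def)

lemma word_val_Cons [simp]:
  "word_val G x ((e, a) # w) = (if e then x else inv x) \<otimes> (a \<otimes> word_val G x w)"
  by (simp add: word_val_def)

lemma word_val_closed [simp, intro]:
  "x \<in> carrier G \<Longrightarrow> snd ` set w \<subseteq> carrier G \<Longrightarrow> word_val G x w \<in> carrier G"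
  by (induction w) auto

lemma word_val_append:
  "x \<in> carrier G \<Longrightarrow> snd ` set w \<subseteq> carrier G \<Longrightarrow> snd ` set w' \<subseteq> carrier G \<Longrightarrow>
   word_val G x (w @ w') = word_val G x w \<otimes> word_val G x w'"
  by (induction w) (auto simp: m_assoc)

text \<open>The last coefficient absorbs \<open>b\<close>, so the number of letters does not grow.
  The empty word has no coefficient that could do so.\<close>

lemma word_val_mult_right:
  assumes "subgroup H G" "x \<in> carrier G" "snd ` set w \<subseteq> H" "b \<in> H" "w \<noteq> []"
  obtains w' where "length w' = length w" "snd ` set w' \<subseteq> H"
    "word_val G x w' = word_val G x w \<otimes> b"
proof -
  have HG: "H \<subseteq> carrier G" using assms(1) subgroup.subset by blast
  obtain v e a where w: "w = v @ [(e, a)]" using assms(5) by (metis rev_exhaust surj_pair)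
  let ?w = "v @ [(e, a \<otimes> b)]"
  have "a \<otimes> b \<in> H" using assms w by (auto intro: subgroup.m_closed)
  then have "snd ` set ?w \<subseteq> H" using assms(3) w by auto
  moreover have "word_val G x ?w = word_val G x w \<otimes> b"
    using assms(2-4) HG w \<open>a \<otimes> b \<in> H\<close> by (auto simp: word_val_append m_assoc subset_iff image_iff)
  ultimately show thesis using that[of ?w] w by simp
qed

text \<open>In a product, the last coefficient of the left word absorbs the leading coefficient of
  the right factor, so this normal form is closed under multiplication.\<close>

lemma generate_insert_word:
  assumes H: "subgroup H G" and x: "x \<in> carrier G" and u: "u \<in> generate G (insert x H)"
  shows "\<exists>a\<in>H. \<exists>w. snd ` set w \<subseteq> H \<and> u = a \<otimes> word_val G x w"
  using u
proof (induction rule: generate.induct)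
  case one
  show ?case using subgroup.one_closed[OF H]
    by (intro bexI[of _ \<one>] exI[of _ "[]"]) auto
next
  case (incl h)
  show ?case
  proof (cases "h = x")
    case True
    then show ?thesis using subgroup.one_closed[OF H] x
      by (intro bexI[of _ \<one>] exI[of _ "[(True, \<one>)]"]) auto
  next
    case False
    then show ?thesis using incl subgroup.mem_carrier[OF H]
      by (intro bexI[of _ h] exI[of _ "[]"]) auto
  qed
next
  case (inv h)
  show ?case
  proof (cases "h = x")
    case True
    then show ?thesis using subgroup.one_closed[OF H] x
      by (intro bexI[of _ \<one>] exI[of _ "[(False, \<one>)]"]) auto
  next
    case False
    then show ?thesis using inv subgroup.mem_carrier[OF H] subgroup.m_inv_closed[OF H]
      by (intro bexI[of _ "inv h"] exI[of _ "[]"]) auto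
  qed
next
  case (eng h1 h2)
  have HG: "H \<subseteq> carrier G" using H subgroup.subset by blast
  obtain a w where 1: "a \<in> H" "snd ` set w \<subseteq> H" "h1 = a \<otimes> word_val G x w" using eng.IH(1) by blast
  obtain b v where 2: "b \<in> H" "snd ` set v \<subseteq> H" "h2 = b \<otimes> word_val G x v" using eng.IH(2) by blast
  have cl: "a \<in> carrier G" "b \<in> carrier G" "word_val G x w \<in> carrier G" "word_val G x v \<in> carrier G"
    using 1 2 HG x by (auto intro: word_val_closed)
  show ?case
  proof (cases "w = []")
    case True
    then show ?thesis using 1 2 cl subgroup.m_closed[OF H]
      by (intro bexI[of _ "a \<otimes> b"] exI[of _ v]) (auto simp: m_assoc)
  next
    case False
    obtain w' where w': "snd ` set w' \<subseteq> H" "word_val G x w' = word_val G x w \<otimes> b"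
      using word_val_mult_right[OF H x 1(2) 2(1) False] by metis
    have "word_val G x (w' @ v) = word_val G x w' \<otimes> word_val G x v"
      using w'(1) 2(2) HG x by (intro word_val_append) auto
    then have "h1 \<otimes> h2 = a \<otimes> word_val G x (w' @ v)"
      using w'(2) 1 2 cl by (simp add: m_assoc)
    then show ?thesis using w'(1) 1 2 by (intro bexI[of _ a] exI[of _ "w' @ v"]) auto
  qed
qed

text \<open>Rotation turns a product \<open>t \<otimes> d\<close> into \<open>d \<otimes> t\<close>,
  which is its conjugate by \<open>inv t\<close>.\<close>

lemma word_val_rotate:
  assumes "x \<in> carrier G" "snd ` set w \<subseteq> carrier G"
  obtains c where "c \<in> carrier G" "word_val G x (rotate i w) = c \<otimes> word_val G x w \<otimes> inv c"
proof -
  let ?k = "i mod length w"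
  let ?t = "word_val G x (take ?k w)" and ?d = "word_val G x (drop ?k w)"
  have sub: "snd ` set (take ?k w) \<subseteq> carrier G" "snd ` set (drop ?k w) \<subseteq> carrier G"
    using assms(2) set_take_subset set_drop_subset by fast+
  have cl: "?t \<in> carrier G" "?d \<in> carrier G" using sub assms(1) by auto
  have "word_val G x w = word_val G x (take ?k w @ drop ?k w)" by simp
  then have "word_val G x w = ?t \<otimes> ?d"
    using word_val_append[OF assms(1) sub] by simp
  moreover have "word_val G x (rotate i w) = ?d \<otimes> ?t"
    using word_val_append[OF assms(1) sub(2,1)] by (simp add: rotate_drop_take)
  ultimately have "word_val G x (rotate i w) = inv ?t \<otimes> word_val G x w \<otimes> inv (inv ?t)"
    using cl by (simp add: m_assoc inv_solve_left)
  then show thesis using that[of "inv ?t"] cl by simp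
qed

lemma conj_conj:
  assumes "c \<in> carrier G" "c' \<in> carrier G" "u \<in> carrier G"
  shows "c' \<otimes> (c \<otimes> u \<otimes> inv c) \<otimes> inv c' = (c' \<otimes> c) \<otimes> u \<otimes> inv (c' \<otimes> c)"
  using assms by (simp add: m_assoc inv_mult_group)

text \<open>Among all conjugates of \<open>u\<close> choose one represented with the least number of letters \<open>x\<close>;
  any cancellation, also a cyclic one, would give a conjugate with fewer letters.\<close>

lemma conjugate_cyclically_reduced:
  assumes H: "subgroup H G" and x: "x \<in> carrier G" and u: "u \<in> generate G (insert x H)"
  obtains c where "c \<in> carrier G" "c \<otimes> u \<otimes> inv c \<in> H"
  | c w where "c \<in> carrier G" "w \<noteq> []" "snd ` set w \<subseteq> H" "cyclically_reduced G w"
      "c \<otimes> u \<otimes> inv c = word_val G x w"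
proof -
  have HG: "H \<subseteq> carrier G" using H subgroup.subset by blast
  have uG: "u \<in> carrier G"
    using generate_in_carrier[of "insert x H"] u x HG by blast
  define Q where "Q n \<longleftrightarrow> (\<exists>c\<in>carrier G. \<exists>a\<in>H. \<exists>w. length w = n \<and> snd ` set w \<subseteq> H \<and>
      c \<otimes> u \<otimes> inv c = a \<otimes> word_val G x w)" for n
  obtain a w where "a \<in> H" "snd ` set w \<subseteq> H" "u = a \<otimes> word_val G x w"
    using generate_insert_word[OF H x u] by blast
  then have "Q (length w)" unfolding Q_def using uG
    by (intro bexI[of _ \<one>] bexI[of _ a] exI[of _ w]) auto
  define n where "n = (LEAST n. Q n)"
  have "Q n" unfolding n_def using \<open>Q (length w)\<close> by (rule LeastI)
  have least: "n \<le> m" if "Q m" for m unfolding n_def using that by (rule Least_le)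
  obtain c a w where w: "c \<in> carrier G" "a \<in> H" "length w = n" "snd ` set w \<subseteq> H"
      "c \<otimes> u \<otimes> inv c = a \<otimes> word_val G x w"
    using \<open>Q n\<close> unfolding Q_def by blast
  have cl: "a \<in> carrier G" "word_val G x w \<in> carrier G" using w HG x by auto
  show thesis
  proof (cases "w = []")
    case True
    then show thesis using w cl that(1)[of c] by simp
  next
    case False
    obtain v where v: "length v = n" "snd ` set v \<subseteq> H" "word_val G x v = word_val G x w \<otimes> a"
      using word_val_mult_right[OF H x w(4,2) False] w(3) by metis
    have vG: "snd ` set v \<subseteq> carrier G" using v(2) HG by blast
    \<comment> \<open>Conjugation by \<open>inv a\<close> moves the leading coefficient to the end,
      where \<open>v\<close> absorbs it without a new letter.\<close>
    let ?c = "inv a \<otimes> c"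
    have cG: "?c \<in> carrier G" using w cl by simp
    have "?c \<otimes> u \<otimes> inv ?c = inv a \<otimes> (c \<otimes> u \<otimes> inv c) \<otimes> inv (inv a)"
      using conj_conj[of c "inv a" u] w(1) cl uG by simp
    also have "\<dots> = word_val G x v"
      unfolding w(5) v(3) using cl by (simp add: m_assoc[symmetric])
    finally have conj: "?c \<otimes> u \<otimes> inv ?c = word_val G x v" .
    have "cyclically_reduced G v"
      unfolding cyclically_reduced_def
    proof (intro allI impI, rule ccontr)
      fix i assume i: "i < length v" "snd (v ! i) = \<one>"
          "fst (v ! i) \<noteq> fst (v ! (Suc i mod length v))"
      \<comment> \<open>A single letter is its own cyclic successor, so a clash of signs involves
        two letters.\<close>
      have n2: "2 \<le> n"
      proof (rule ccontr)
        assume "\<not> 2 \<le> n"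
        then have "length v = 1" using i(1) v(1) by simp
        then show False using i(1,3) by simp
      qed
      \<comment> \<open>Rotation brings the clashing letters to the front, where they cancel. The
        coefficient \<open>b\<close> of the second one becomes a leading coefficient, which
        \<open>Q\<close> allows.\<close>
      let ?r = "rotate i v"
      have r0: "?r ! 0 = v ! i" using i(1) nth_rotate[of 0 v i] by (cases v) auto
      have r1: "?r ! 1 = v ! (Suc i mod length v)" using n2 v(1) nth_rotate[of 1 v i] by simp
      have "length ?r = n" using v(1) by simp
      then obtain p q r where r: "?r = p # q # r" "length r = n - 2" using n2
        by (metis One_nat_def Suc_1 Suc_le_length_iff diff_Suc_1 diff_Suc_Suc length_Cons list.exhaust_sel)
      obtain e where p: "p = (e, \<one>)" using r0 r(1) i(2) by (metis nth_Cons_0 prod.collapse)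
      obtain b where q: "q = (\<not> e, b)"
      proof -
        have "fst p \<noteq> fst q" using r0 r1 r(1) i(3) by simp
        then have "q = (\<not> e, snd q)" using p by (cases q) auto
        then show thesis by (rule that)
      qed
      have rH: "b \<in> H" "snd ` set r \<subseteq> H"
      proof -
        have "snd ` set ?r \<subseteq> H" using v(2) by simp
        then show "b \<in> H" "snd ` set r \<subseteq> H" unfolding r(1) q by auto
      qed
      then have "b \<in> carrier G" "word_val G x r \<in> carrier G" using HG x by auto
      then have red: "word_val G x ?r = b \<otimes> word_val G x r"
        unfolding r(1) p q using x by (auto simp: m_assoc[symmetric])
      obtain c' where c': "c' \<in> carrier G" "word_val G x ?r = c' \<otimes> word_val G x v \<otimes> inv c'"
        using word_val_rotate[OF x vG] by metis
      have "(c' \<otimes> ?c) \<otimes> u \<otimes> inv (c' \<otimes> ?c) = b \<otimes> word_val G x r"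
        using conj_conj[OF cG c'(1) uG] conj c'(2) red by simp
      then have "Q (n - 2)" unfolding Q_def using rH r(2) c'(1) cG by blast
      then show False using least n2 by fastforce
    qed
    moreover have "v \<noteq> []" using False v(1) w(3) by auto
    ultimately show thesis using that(2)[of ?c v] cG v(2) conj by blast
  qed
qed

end

section \<open>Pointwise computation in the group of permutations\<close>

lemma Bij_app: "f \<in> Bij S \<Longrightarrow> x \<in> S \<Longrightarrow> f x \<in> S"
  using Bij_imp_funcset by blast

lemma Bij_eqI: "f \<in> Bij S \<Longrightarrow> g \<in> Bij S \<Longrightarrow> (\<And>x. x \<in> S \<Longrightarrow> f x = g x) \<Longrightarrow> f = g"
  using Bij_imp_extensional extensionalityI by metis

lemma BijGroup_carrier [simp]: "carrier (BijGroup S) = Bij S"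
  by (simp add: BijGroup_def)

lemma BijGroup_mult_app:
  "f \<in> Bij S \<Longrightarrow> g \<in> Bij S \<Longrightarrow> x \<in> S \<Longrightarrow> (f \<otimes>\<^bsub>BijGroup S\<^esub> g) x = f (g x)"
  by (simp add: BijGroup_def compose_def)

lemma BijGroup_one_app: "x \<in> S \<Longrightarrow> \<one>\<^bsub>BijGroup S\<^esub> x = x"
  by (simp add: BijGroup_def)

lemma BijGroup_inv_closed: "f \<in> Bij S \<Longrightarrow> inv\<^bsub>BijGroup S\<^esub> f \<in> Bij S"
  using group.inv_closed[OF group_BijGroup, of f S] by simp

lemma BijGroup_inv_app:
  assumes "f \<in> Bij S" "x \<in> S"
  shows "(inv\<^bsub>BijGroup S\<^esub> f) (f x) = x" "f ((inv\<^bsub>BijGroup S\<^esub> f) x) = x"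
  using group.l_inv[OF group_BijGroup, of f S] group.r_inv[OF group_BijGroup, of f S] assms
    BijGroup_mult_app[OF assms(1) BijGroup_inv_closed[OF assms(1)] assms(2)]
    BijGroup_mult_app[OF BijGroup_inv_closed[OF assms(1)] assms]
    BijGroup_one_app[OF assms(2)] by simp_all

text \<open>The stages \<open>A n\<close> close the generators and their inverses under products.
  Each stage has size at most that of \<open>B\<close>, and countably many stages exhaust the
  generated subgroup.\<close>

lemma (in group) card_of_generate:
  assumes "infinite B" "|X| \<le>o |B|"
  shows "|generate G X| \<le>o |B|"
proof -
  define A where "A = rec_nat (insert \<one> (X \<union> m_inv G ` X)) (\<lambda>_ Y. Y \<union> (\<lambda>(a, b). a \<otimes> b) ` (Y \<times> Y))"
  have A0: "A 0 = insert \<one> (X \<union> m_inv G ` X)"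
    and AS: "\<And>n. A (Suc n) = A n \<union> (\<lambda>(a, b). a \<otimes> b) ` (A n \<times> A n)"
    by (simp_all add: A_def)
  have Un: "|Y \<union> Z| \<le>o |B|" if "|Y| \<le>o |B|" "|Z| \<le>o |B|" for Y Z :: "'a set"
    using card_of_Un_ordLeq_infinite_Field[of "|B|" Y Z] that assms(1) by (simp add: Field_card_of card_of_card_order_on)
  have "|A n| \<le>o |B|" for n
  proof (induction n)
    case 0
    have "|m_inv G ` X| \<le>o |B|" using card_of_image assms(2) ordLeq_transitive by blast
    moreover have "|{\<one>}| \<le>o |B|"
      using assms(1) card_of_singl_ordLeq[of B] by force
    ultimately have "|{\<one>} \<union> (X \<union> m_inv G ` X)| \<le>o |B|" using assms(2) Un by metis
    then show ?case by (simp add: A0)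
  next
    case (Suc n)
    have "|A n \<times> A n| \<le>o |B|"
      using card_of_Times_ordLeq_infinite_Field[of "|B|" "A n" "A n"] Suc assms(1)
      by (simp add: Field_card_of card_of_card_order_on)
    then have "|(\<lambda>(a, b). a \<otimes> b) ` (A n \<times> A n)| \<le>o |B|" using card_of_image ordLeq_transitive by blast
    then show ?case unfolding AS using Suc Un by blast
  qed
  moreover have "|UNIV :: nat set| \<le>o |B|" using assms(1) infinite_iff_card_of_nat by blast
  ultimately have "|\<Union>n. A n| \<le>o |B|" using card_of_UNION_ordLeq_infinite[OF assms(1)] by blast
  moreover have "generate G X \<subseteq> (\<Union>n. A n)"
  proof
    fix u assume "u \<in> generate G X"
    then have "\<exists>n. u \<in> A n"
    proof (induction rule: generate.induct)
      case (eng a b)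
      then obtain m n where mn: "a \<in> A m" "b \<in> A n" by blast
      have mono: "i \<le> j \<Longrightarrow> A i \<subseteq> A j" for i j
        by (rule lift_Suc_mono_le[of A]) (auto simp: AS)
      have "a \<in> A (max m n)" "b \<in> A (max m n)"
        using mn mono[of m "max m n"] mono[of n "max m n"] by auto
      then have "a \<otimes> b \<in> A (Suc (max m n))" unfolding AS by force
      then show ?case by blast
    qed (use A0 in auto)
    then show "u \<in> (\<Union>n. A n)" by blast
  qed
  ultimately show ?thesis using card_of_mono1 ordLeq_transitive by blast
qed

lemma card_of_insert_ordLeq:
  assumes "infinite B" "|X| \<le>o |B|"
  shows "|insert x X| \<le>o |B|"
proof -
  have "|{x}| \<le>o |B|" using assms(1) card_of_singl_ordLeq[of B x] by force
  then have "|{x} \<union> X| \<le>o |B|"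
    using card_of_Un_ordLeq_infinite_Field[of "|B|" "{x}" X] assms
    by (simp add: Field_card_of card_of_card_order_on)
  then show ?thesis by simp
qed

section \<open>Small and bounded subsets of a regular cardinal\<close>

locale regular_cardinal =
  fixes \<kappa> :: "'a rel"
  assumes card: "Card_order \<kappa>"
    and infinite: "infinite (Field \<kappa>)"
    and regular: "regularCard \<kappa>"
begin

abbreviation K :: "'a set" where "K \<equiv> Field \<kappa>"

abbreviation small :: "'b set \<Rightarrow> bool" where "small X \<equiv> |X| <o \<kappa>"

definition le :: "'a \<Rightarrow> 'a \<Rightarrow> bool"  (infix "\<preceq>" 50)
  where "x \<preceq> y \<longleftrightarrow> (x, y) \<in> \<kappa>"

definition lt :: "'a \<Rightarrow> 'a \<Rightarrow> bool"  (infix "\<prec>" 50)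
  where "x \<prec> y \<longleftrightarrow> (x, y) \<in> \<kappa> \<and> x \<noteq> y"

section \<open>The order on \<kappa>\<close>

lemma well_order: "Well_order \<kappa>"
  using card by (simp add: card_order_on_def)

lemma le_in_K: "x \<preceq> y \<Longrightarrow> x \<in> K \<and> y \<in> K"
  by (auto simp: le_def Field_def)

lemma lt_in_K: "x \<prec> y \<Longrightarrow> x \<in> K \<and> y \<in> K"
  by (auto simp: lt_def Field_def)

lemma le_refl: "x \<in> K \<Longrightarrow> x \<preceq> x"
  using well_order by (auto simp: le_def order_on_defs refl_on_def)

lemma le_trans: "x \<preceq> y \<Longrightarrow> y \<preceq> z \<Longrightarrow> x \<preceq> z"
  using well_order unfolding le_def order_on_defs trans_def by blast

lemma le_antisym: "x \<preceq> y \<Longrightarrow> y \<preceq> x \<Longrightarrow> x = y"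
  using well_order unfolding le_def order_on_defs antisym_def by blast

lemma lt_irrefl: "\<not> x \<prec> x"
  by (simp add: lt_def)

lemma lt_iff: "x \<prec> y \<longleftrightarrow> x \<preceq> y \<and> x \<noteq> y"
  by (simp add: le_def lt_def)

lemma lt_le: "x \<prec> y \<Longrightarrow> x \<preceq> y"
  by (simp add: lt_iff)

lemma le_lt_trans: "x \<preceq> y \<Longrightarrow> y \<prec> z \<Longrightarrow> x \<prec> z"
  using le_trans le_antisym unfolding lt_iff by blast

lemma lt_le_trans: "x \<prec> y \<Longrightarrow> y \<preceq> z \<Longrightarrow> x \<prec> z"
  using le_trans le_antisym unfolding lt_iff by blast

lemma lt_trans: "x \<prec> y \<Longrightarrow> y \<prec> z \<Longrightarrow> x \<prec> z"
  using le_lt_trans lt_le by blast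

lemma not_le: "x \<in> K \<Longrightarrow> y \<in> K \<Longrightarrow> \<not> x \<preceq> y \<longleftrightarrow> y \<prec> x"
  using well_order le_antisym le_refl unfolding order_on_defs total_on_def le_def lt_def by metis

lemma not_lt: "x \<in> K \<Longrightarrow> y \<in> K \<Longrightarrow> \<not> x \<prec> y \<longleftrightarrow> y \<preceq> x"
  using not_le by blast

lemma wf_lt: "wf {(x, y). x \<prec> y}"
proof -
  have "{(x, y). x \<prec> y} = \<kappa> - Id" by (auto simp: lt_def)
  then show ?thesis using well_order by (simp add: well_order_on_def)
qed

lemma exists_lt: "x \<in> K \<Longrightarrow> \<exists>y\<in>K. x \<prec> y"
  using infinite_Card_order_limit[OF card infinite] by (auto simp: lt_def)

section \<open>Sets of size less than \<kappa>\<close>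

lemma small_subset: "small X \<Longrightarrow> Y \<subseteq> X \<Longrightarrow> small Y"
  using card_of_mono1 ordLeq_ordLess_trans by blast

lemma small_Un: "small X \<Longrightarrow> small Y \<Longrightarrow> small (X \<union> Y)"
  using card_of_Un_ordLess_infinite_Field[OF infinite card] by blast

lemma small_image: "small X \<Longrightarrow> small (f ` X)"
  using card_of_image ordLeq_ordLess_trans by blast

lemma small_image_cover: "small X \<Longrightarrow> Y \<subseteq> f ` X \<Longrightarrow> small Y"
  using small_image small_subset by blast

lemma small_finite: "finite X \<Longrightarrow> small X"
  using finite_ordLess_infinite[OF card_of_Well_order well_order] infinite by (simp add: Field_card_of)

text \<open>Regularity enters through the stability of regular cardinals under small unions.\<close>

lemma small_UN: "small I \<Longrightarrow> (\<And>i. i \<in> I \<Longrightarrow> small (A i)) \<Longrightarrow> small (\<Union>i\<in>I. A i)"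
  using stable_UNION[OF regularCard_stable[OF card infinite regular]] by blast

lemma small_times: "small X \<Longrightarrow> small Y \<Longrightarrow> small (X \<times> Y)"
proof -
  assume "small X" "small Y"
  then have "small (\<Union>x\<in>X. Pair x ` Y)" by (intro small_UN small_image)
  moreover have "(\<Union>x\<in>X. Pair x ` Y) = X \<times> Y" by auto
  ultimately show ?thesis by simp
qed

lemma small_below: "b \<in> K \<Longrightarrow> small {x. x \<prec> b}"
proof -
  assume "b \<in> K"
  moreover have "{x. x \<prec> b} = underS \<kappa> b" by (auto simp: lt_def underS_def)
  ultimately show ?thesis using card_of_underS[OF card] by simp
qed

lemma small_below_le: "b \<in> K \<Longrightarrow> small {x. x \<preceq> b}"
proof -
  assume b: "b \<in> K"
  then have "small ({x. x \<prec> b} \<union> {b})" by (intro small_Un small_below small_finite) auto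
  then show ?thesis by (rule small_subset) (auto simp: lt_iff)
qed

text \<open>By regularity a small set is not cofinal. Since \<kappa> has no last element, one step
  further makes the bound strict.\<close>

lemma small_bounded:
  assumes "small X" "X \<subseteq> K"
  obtains b where "b \<in> K" "\<And>x. x \<in> X \<Longrightarrow> x \<prec> b"
proof -
  have "\<not> cofinal X \<kappa>" using assms regular not_ordLess_ordIso unfolding regularCard_def by blast
  then obtain a where a: "a \<in> K" "\<And>x. x \<in> X \<Longrightarrow> \<not> a \<prec> x"
    unfolding cofinal_def lt_def by blast
  obtain b where "b \<in> K" "a \<prec> b" using exists_lt a by blast
  moreover have "x \<prec> b" if "x \<in> X" for x
    using a that assms not_lt le_lt_trans \<open>a \<prec> b\<close> by blast
  ultimately show thesis using that by blast
qed

lemma small_bounded_image: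
  assumes "small I" "\<And>i. i \<in> I \<Longrightarrow> f i \<in> K"
  obtains b where "b \<in> K" "\<And>i. i \<in> I \<Longrightarrow> f i \<prec> b"
  using small_bounded[of "f ` I"] small_image[OF assms(1)] assms(2) by (metis image_eqI image_subsetI)

lemma not_small_unbounded:
  assumes "\<not> small Y" "Y \<subseteq> K" "small X" "X \<subseteq> K"
  obtains y where "y \<in> Y" "\<And>x. x \<in> X \<Longrightarrow> x \<prec> y"
proof -
  obtain b where b: "b \<in> K" "\<And>x. x \<in> X \<Longrightarrow> x \<prec> b" using small_bounded assms by metis
  have "\<not> Y \<subseteq> {x. x \<prec> b}" using small_below[OF b(1)] small_subset assms(1) by blast
  then obtain y where "y \<in> Y" "\<not> y \<prec> b" by blast
  then show thesis using that b not_lt assms(2) lt_le_trans by blast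
qed

lemma unbounded_not_small:
  assumes "\<And>b. b \<in> K \<Longrightarrow> \<exists>y\<in>Y. b \<preceq> y"
  shows "\<not> small Y"
proof
  assume "small Y"
  then have "small (Y \<inter> K)" by (rule small_subset) auto
  then obtain b where b: "b \<in> K" "\<And>x. x \<in> Y \<inter> K \<Longrightarrow> x \<prec> b" using small_bounded by blast
  then obtain y where "y \<in> Y" "b \<preceq> y" using assms by blast
  then show False using b le_in_K le_lt_trans lt_irrefl by blast
qed

lemma not_small_K: "\<not> small K"
  using unbounded_not_small le_refl by blast

lemma not_small_ordIso: "X \<subseteq> K \<Longrightarrow> \<not> small X \<Longrightarrow> |X| =o \<kappa>"
  using card_of_mono1[of X K] card_of_Field_ordIso[OF card]
  by (meson card card_of_Well_order card_order_on_well_order_on not_ordLeq_ordLess ordIso_iff_ordLeq ordLeq_ordIso_trans ordLess_or_ordLeq)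

lemma not_small_diff: "\<not> small Y \<Longrightarrow> small X \<Longrightarrow> \<not> small (Y - X)"
  using small_Un small_subset by (metis Un_Diff_cancel2 sup_ge1)

lemma card_power: "ctwo ^c \<kappa> =o |Pow K|"
proof -
  have "ctwo ^c \<kappa> = |Func K (UNIV :: bool set)|"
    by (simp add: cexp_def ctwo_def Field_card_of)
  then show ?thesis using card_of_Pow_Func ordIso_symmetric by metis
qed

text \<open>With pairs coded by \<open>p\<close>, a pseudointersection of the sets of pairs \<open>(x, y)\<close> with \<open>y\<close> above
  all values of \<open>f\<close> up to \<open>x\<close>, and of the sets of pairs with \<open>x\<close> beyond a bound, contains a pair
  \<open>(x', y)\<close> beyond each \<open>x\<close>; its \<open>y\<close> serves as \<open>d x\<close>.\<close>

lemma dominating_function: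
  assumes pseudo: "\<And>F. F \<subseteq> Pow K \<Longrightarrow> strong_intersection_property \<kappa> F \<Longrightarrow> |F| <o |Pow K| \<Longrightarrow>
                     \<exists>A. is_pseudointersection \<kappa> F A"
    and F: "|F| <o |Pow K|" "\<And>f x. f \<in> F \<Longrightarrow> x \<in> K \<Longrightarrow> f x \<in> K"
  obtains d where "\<And>x. x \<in> K \<Longrightarrow> x \<preceq> d x" "\<And>f. f \<in> F \<Longrightarrow> small {x \<in> K. \<not> f x \<preceq> d x}"
proof -
  have K_nonempty: "\<exists>c. c \<in> K" using infinite infinite_imp_nonempty by blast
  obtain p where p: "bij_betw p (K \<times> K) K"
    using card_of_Times_same_infinite[OF infinite] card_of_ordIso by blast
  then have pK: "p (x, y) \<in> K" if "x \<in> K" "y \<in> K" for x y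
    using that by (auto simp: bij_betw_def)
  have pinj: "p (x, y) = p (x', y') \<Longrightarrow> x = x' \<and> y = y'"
    if "x \<in> K" "y \<in> K" "x' \<in> K" "y' \<in> K" for x y x' y'
    using p that unfolding bij_betw_def inj_on_def by blast
  \<comment> \<open>The bound covers all arguments up to \<open>x\<close>, so that a pair whose
    first entry lies beyond \<open>x\<close> still controls the value \<open>f x\<close>.\<close>
  define A where "A f = p ` {(x, y). x \<in> K \<and> y \<in> K \<and> (\<forall>x'. x' \<preceq> x \<longrightarrow> f x' \<preceq> y)}" for f
  define C where "C c = p ` {(x, y). y \<in> K \<and> c \<preceq> x}" for c
  define FF where "FF = A ` F \<union> C ` K"
  have FK: "FF \<subseteq> Pow K"
    using pK le_in_K by (auto simp: FF_def A_def C_def)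
  have "infinite (Pow K)" using infinite by simp
  then have FF: "|FF| <o |Pow K|" unfolding FF_def
    using card_of_Un_ordLess_infinite[of "Pow K" "A ` F" "C ` K"]
      card_of_image ordLeq_ordLess_trans F(1) card_of_Pow by metis
  \<comment> \<open>Membership holds for all large \<open>x\<close> and then for all
    \<open>y\<close> beyond a bound depending on \<open>x\<close>. This two-step largeness passes to
    intersections of fewer than \<kappa> members.\<close>
  have ev: "\<exists>c\<in>K. \<forall>x. c \<preceq> x \<longrightarrow> (\<exists>b\<in>K. \<forall>y. b \<preceq> y \<longrightarrow> p (x, y) \<in> B)" if B: "B \<in> FF" for B
  proof -
    consider f where "f \<in> F" "B = A f" | c where "c \<in> K" "B = C c" using B by (auto simp: FF_def)
    then show ?thesis
    proof cases
      case 1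
      have "\<exists>b\<in>K. \<forall>y. b \<preceq> y \<longrightarrow> p (x, y) \<in> B" if x: "x \<in> K" for x
      proof -
        have "f x' \<in> K" if "x' \<in> {x'. x' \<preceq> x}" for x' using that F(2) 1(1) le_in_K by blast
        then obtain b where b: "b \<in> K" "\<And>x'. x' \<in> {x'. x' \<preceq> x} \<Longrightarrow> f x' \<prec> b"
          using small_bounded_image[OF small_below_le[OF x], of f] by metis
        have "p (x, y) \<in> B" if "b \<preceq> y" for y
        proof -
          have "y \<in> K" using that le_in_K by blast
          moreover have "f x' \<preceq> y" if "x' \<preceq> x" for x'
            using b(2)[of x'] that \<open>b \<preceq> y\<close> lt_le_trans lt_le by blast
          ultimately show ?thesis unfolding 1(2) A_def using x by (intro imageI) simp
        qed
        then show ?thesis using b(1) by blast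
      qed
      then show ?thesis using K_nonempty le_in_K by blast
    next
      case 2
      then show ?thesis unfolding C_def using le_in_K by blast
    qed
  qed
  have "strong_intersection_property \<kappa> FF"
    unfolding strong_intersection_property_def
  proof (intro allI impI, elim conjE)
    fix F' assume F': "F' \<subseteq> FF" "small F'"
    then have "\<forall>B\<in>F'. \<exists>c. c \<in> K \<and> (\<forall>x. c \<preceq> x \<longrightarrow> (\<exists>b\<in>K. \<forall>y. b \<preceq> y \<longrightarrow> p (x, y) \<in> B))"
      using ev by blast
    then obtain c where c: "\<And>B. B \<in> F' \<Longrightarrow> c B \<in> K"
        "\<And>B x. B \<in> F' \<Longrightarrow> c B \<preceq> x \<Longrightarrow> \<exists>b\<in>K. \<forall>y. b \<preceq> y \<longrightarrow> p (x, y) \<in> B"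
      by metis
    then obtain x where x: "x \<in> K" "\<And>B. B \<in> F' \<Longrightarrow> c B \<prec> x"
      using small_bounded_image[OF F'(2), of c] c(1) by metis
    then have "\<forall>B\<in>F'. \<exists>b. b \<in> K \<and> (\<forall>y. b \<preceq> y \<longrightarrow> p (x, y) \<in> B)"
      using c(2) lt_le by blast
    then obtain b where b: "\<And>B. B \<in> F' \<Longrightarrow> b B \<in> K"
        "\<And>B y. B \<in> F' \<Longrightarrow> b B \<preceq> y \<Longrightarrow> p (x, y) \<in> B"
      by metis
    then obtain y0 where y0: "y0 \<in> K" "\<And>B. B \<in> F' \<Longrightarrow> b B \<prec> y0"
      using small_bounded_image[OF F'(2), of b] b(1) by metis
    \<comment> \<open>The column over \<open>x\<close> from \<open>y0\<close> on lies in the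
      intersection, which is therefore large.\<close>
    have sub: "(\<lambda>y. p (x, y)) ` {y. y0 \<preceq> y} \<subseteq> K \<inter> \<Inter>F'"
    proof (intro image_subsetI IntI InterI)
      fix y assume "y \<in> {y. y0 \<preceq> y}"
      then have y: "y0 \<preceq> y" "y \<in> K" using le_in_K by auto
      then show "p (x, y) \<in> K" using pK x by simp
      show "p (x, y) \<in> B" if "B \<in> F'" for B
        using b(2)[OF that] y0(2)[OF that] y(1) lt_le le_trans by blast
    qed
    have "\<not> small {y. y0 \<preceq> y}"
    proof (rule unbounded_not_small)
      fix b assume "b \<in> K"
      then show "\<exists>y\<in>{y. y0 \<preceq> y}. b \<preceq> y" using y0(1) le_refl not_le lt_le by blast
    qed
    moreover have "{y. y0 \<preceq> y} \<subseteq> (snd \<circ> inv_into (K \<times> K) p) ` (K \<inter> \<Inter>F')"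
    proof
      fix y assume y: "y \<in> {y. y0 \<preceq> y}"
      then have "p (x, y) \<in> K \<inter> \<Inter>F'" using sub by blast
      moreover have "(snd \<circ> inv_into (K \<times> K) p) (p (x, y)) = y"
        using y x p le_in_K by (simp add: bij_betw_inv_into_left)
      ultimately show "y \<in> (snd \<circ> inv_into (K \<times> K) p) ` (K \<inter> \<Inter>F')" by (metis image_eqI)
    qed
    ultimately have "\<not> small (K \<inter> \<Inter>F')" using small_image_cover by blast
    then show "|K \<inter> \<Inter> F'| =o \<kappa>" using not_small_ordIso by blast
  qed
  then obtain E where E: "E \<subseteq> K" "|E| =o \<kappa>" "\<And>B. B \<in> FF \<Longrightarrow> small (E - B)"
    using pseudo[OF FK _ FF] unfolding is_pseudointersection_def almost_contained_def by blast
  have Elarge: "\<not> small E" using E(2) not_ordLess_ordIso by blast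
  \<comment> \<open>\<open>E\<close> is large and almost contained in \<open>C x\<close>, so it
    meets \<open>C x\<close>.\<close>
  have "\<exists>y. y \<in> K \<and> (\<exists>x'. x \<preceq> x' \<and> p (x', y) \<in> E)" if x: "x \<in> K" for x
  proof -
    have "small (E - C x)" using E(3)[of "C x"] x by (simp add: FF_def)
    then have "\<not> E \<subseteq> E - C x" using Elarge small_subset by blast
    then show ?thesis unfolding C_def by blast
  qed
  then obtain y where y: "\<And>x. x \<in> K \<Longrightarrow> y x \<in> K" "\<And>x. x \<in> K \<Longrightarrow> \<exists>x'. x \<preceq> x' \<and> p (x', y x) \<in> E"
    by metis
  define d where "d x = (if x \<preceq> y x then y x else x)" for x
  have d: "x \<preceq> d x" "y x \<preceq> d x" if "x \<in> K" for x
    using that y(1)[OF that] le_refl not_le lt_le unfolding d_def by (auto split: if_splits)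
  have "small {x \<in> K. \<not> f x \<preceq> d x}" if f: "f \<in> F" for f
  proof -
    have "small (E - A f)" using E(3)[of "A f"] f by (simp add: FF_def)
    then have "small ((fst \<circ> inv_into (K \<times> K) p) ` (E - A f))" by (rule small_image)
    moreover have "(fst \<circ> inv_into (K \<times> K) p) ` (E - A f) \<subseteq> K"
    proof (rule image_subsetI)
      fix e assume "e \<in> E - A f"
      then have "e \<in> p ` (K \<times> K)" using E(1) p by (auto simp: bij_betw_def)
      then have "inv_into (K \<times> K) p e \<in> K \<times> K" by (rule inv_into_into)
      then show "(fst \<circ> inv_into (K \<times> K) p) e \<in> K" by (simp add: mem_Times_iff)
    qed
    ultimately obtain b where b: "b \<in> K"
        "\<And>x. x \<in> (fst \<circ> inv_into (K \<times> K) p) ` (E - A f) \<Longrightarrow> x \<prec> b"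
      using small_bounded by blast
    \<comment> \<open>A failure of domination at \<open>x\<close> keeps the code of
      \<open>(x', y x)\<close> out of \<open>A f\<close>, which puts \<open>x'\<close> and with it
      \<open>x\<close> below \<open>b\<close>.\<close>
    have "x \<prec> b" if x: "x \<in> K" "\<not> f x \<preceq> d x" for x
    proof (rule ccontr)
      assume "\<not> x \<prec> b"
      then have "b \<preceq> x" using x b not_lt by blast
      obtain x' where x': "x \<preceq> x'" "p (x', y x) \<in> E" using y(2) x(1) by blast
      have x'K: "x' \<in> K" "y x \<in> K" using x' le_in_K y x by blast+
      have "p (x', y x) \<notin> A f"
      proof
        assume "p (x', y x) \<in> A f"
        then have "f x \<preceq> y x" using x'(1) pinj x'K unfolding A_def by blast
        then show False using x d(2) le_trans by blast
      qed
      moreover have "(fst \<circ> inv_into (K \<times> K) p) (p (x', y x)) = x'"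
        using p x'K by (simp add: bij_betw_inv_into_left)
      ultimately have "x' \<prec> b" using b(2) x'(2) by (metis Diff_iff image_eqI)
      then show False using \<open>b \<preceq> x\<close> x'(1) le_trans le_lt_trans lt_irrefl by blast
    qed
    then have "{x \<in> K. \<not> f x \<preceq> d x} \<subseteq> {x. x \<prec> b}" by blast
    then show ?thesis using small_below[OF b(1)] small_subset by blast
  qed
  then show thesis using that d(1) by blast
qed

section \<open>Upper and lower ends of edges\<close>

definition hi :: "'a \<times> 'a \<Rightarrow> 'a"
  where "hi e = (if fst e \<preceq> snd e then snd e else fst e)"

definition lo :: "'a \<times> 'a \<Rightarrow> 'a"
  where "lo e = (if fst e \<preceq> snd e then fst e else snd e)"

lemma hi_lo_cases: "hi e = fst e \<and> lo e = snd e \<or> hi e = snd e \<and> lo e = fst e"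
  by (simp add: hi_def lo_def)

lemma hi_ge:
  assumes "fst e \<in> K" "snd e \<in> K"
  shows "fst e \<preceq> hi e" "snd e \<preceq> hi e"
  using assms le_refl not_le lt_le by (auto simp: hi_def)

lemma hi_lo_upward:
  assumes "x \<prec> t"
  shows "hi (x, t) = t" "lo (x, t) = x" "hi (t, x) = t" "lo (t, x) = x"
  using assms le_lt_trans lt_irrefl lt_le by (auto simp: hi_def lo_def)

lemma small_Bij_preimage:
  assumes "f \<in> Bij K" "small X"
  shows "small {x \<in> K. f x \<in> X}"
proof -
  have "{x \<in> K. f x \<in> X} \<subseteq> (inv\<^bsub>BijGroup K\<^esub> f) ` X"
    using BijGroup_inv_app(1)[OF assms(1)] by force
  then show ?thesis using small_image_cover assms(2) by blast
qed

lemma finite_has_max: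
  "finite A \<Longrightarrow> A \<noteq> {} \<Longrightarrow> A \<subseteq> K \<Longrightarrow> \<exists>m\<in>A. \<forall>x\<in>A. x \<preceq> m"
proof (induction rule: finite_ne_induct)
  case (singleton x)
  then show ?case using le_refl by simp
next
  case (insert x A)
  have xA: "x \<in> K" "A \<subseteq> K" using insert.prems by simp_all
  then obtain m where m: "m \<in> A" "\<And>y. y \<in> A \<Longrightarrow> y \<preceq> m" using insert.IH by blast
  show ?case
  proof (cases "x \<preceq> m")
    case True
    then have "\<forall>y\<in>insert x A. y \<preceq> m" using m(2) by simp
    then show ?thesis using m(1) by blast
  next
    case False
    moreover have "m \<in> K" using m(1) xA(2) by blast
    ultimately have "m \<preceq> x" using not_le[OF xA(1)] lt_le by simp
    then have "\<forall>y\<in>insert x A. y \<preceq> x" using le_trans[OF m(2)] le_refl[OF xA(1)] by simp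
    then show ?thesis by blast
  qed
qed

end

section \<open>Sparse permutations\<close>

text \<open>\<open>R\<close> is a family of small sets of edges; unboundedly many of them are to become part of the
  graph of the new permutation. Only two edges from a common member of \<open>R\<close> may have upper ends that
  are close to each other as measured by \<open>d\<close>.\<close>

locale sparse_extension = regular_cardinal \<kappa> for \<kappa> :: "'a rel" +
  fixes d :: "'a \<Rightarrow> 'a" and K0 :: "'a set" and col :: "'a \<Rightarrow> 'c"
    and R :: "('a \<times> 'a) set set"
  assumes d: "x \<in> K \<Longrightarrow> x \<preceq> d x"
    and K0: "K0 \<subseteq> K"
    and large: "x \<in> K0 \<Longrightarrow> \<not> small {y \<in> K0. col y = col x}"
begin

definition good_edge :: "'a \<times> 'a \<Rightarrow> bool" where
  "good_edge e \<longleftrightarrow> fst e \<in> K0 \<and> snd e \<in> K0 \<and> col (fst e) = col (snd e) \<and> d (lo e) \<prec> hi e"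

text \<open>The first two conditions make a sparse set the graph of a partial injection. Of the two
  premises about \<open>d\<close>, one holds anyway because \<open>d\<close> is inflationary; the
  other says that the higher upper end is within the \<open>d\<close>-image of the lower
  one.\<close>

definition compatible :: "'a \<times> 'a \<Rightarrow> 'a \<times> 'a \<Rightarrow> bool" where
  "compatible e e' \<longleftrightarrow> fst e \<noteq> fst e' \<and> snd e \<noteq> snd e' \<and> hi e \<noteq> hi e' \<and>
     (hi e \<preceq> d (hi e') \<longrightarrow> hi e' \<preceq> d (hi e) \<longrightarrow> (\<exists>r\<in>R. e \<in> r \<and> e' \<in> r))"

definition sparse :: "('a \<times> 'a) set \<Rightarrow> bool" where
  "sparse U \<longleftrightarrow> (\<forall>e\<in>U. good_edge e) \<and> (\<forall>e\<in>U. \<forall>e'\<in>U. e \<noteq> e' \<longrightarrow> compatible e e')"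

section \<open>Extending small sparse sets of edges\<close>

lemma good_edgeD:
  assumes "good_edge e"
  shows "fst e \<in> K" "snd e \<in> K" "hi e \<in> K" "lo e \<in> K" "hi e \<preceq> d (hi e)"
    "fst e \<preceq> hi e" "snd e \<preceq> hi e"
proof -
  show 1: "fst e \<in> K" "snd e \<in> K" using assms K0 by (auto simp: good_edge_def)
  then show "fst e \<preceq> hi e" "snd e \<preceq> hi e" using hi_ge by blast+
  show "hi e \<in> K" "lo e \<in> K" "hi e \<preceq> d (hi e)"
    using 1 d hi_lo_cases[of e] by metis+
qed

lemma compatible_sym: "compatible e e' \<Longrightarrow> compatible e' e"
  unfolding compatible_def by metis

text \<open>The upper ends in \<open>V\<close> lie beyond the \<open>d\<close>-images of those in
  \<open>U\<close>, so the last clause of \<open>compatible\<close> holds vacuously between the two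
  sets.\<close>

lemma sparse_Un:
  assumes "sparse U" "sparse V"
    and "\<And>e e'. e \<in> U \<Longrightarrow> e' \<in> V \<Longrightarrow> fst e \<noteq> fst e' \<and> snd e \<noteq> snd e' \<and> d (hi e) \<prec> hi e'"
  shows "sparse (U \<union> V)"
proof -
  have UV: "compatible e e'" if "e \<in> U" "e' \<in> V" for e e'
  proof -
    have ge: "good_edge e" "good_edge e'" using that assms(1,2) by (auto simp: sparse_def)
    have lt: "d (hi e) \<prec> hi e'" using assms(3) that by blast
    then have "\<not> hi e' \<preceq> d (hi e)" using le_lt_trans lt_irrefl by blast
    moreover from this have "hi e \<noteq> hi e'" using good_edgeD(5)[OF ge(1)] by auto
    ultimately show ?thesis using assms(3)[OF that] by (auto simp: compatible_def)
  qed
  show ?thesis unfolding sparse_def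
  proof (intro conjI ballI impI)
    fix e assume "e \<in> U \<union> V"
    then show "good_edge e" using assms(1,2) by (auto simp: sparse_def)
  next
    fix e e' assume "e \<in> U \<union> V" "e' \<in> U \<union> V" "e \<noteq> e'"
    then show "compatible e e'"
      using UV[of e e'] compatible_sym[OF UV[of e' e]] assms(1,2) by (auto simp: sparse_def)
  qed
qed

text \<open>The points of \<open>K0\<close> with the colour of \<open>x\<close> are unbounded by
  \<open>large\<close>, while the points to be exceeded form a small, hence bounded, set.\<close>

lemma fresh_hi:
  assumes "small U" "sparse U" "x \<in> K0"
  obtains t where "t \<in> K0" "col t = col x" "d x \<prec> t"
    "\<And>e. e \<in> U \<Longrightarrow> d (hi e) \<prec> t \<and> fst e \<prec> t \<and> snd e \<prec> t"
proof -
  let ?X = "{d x} \<union> (\<lambda>e. d (hi e)) ` U \<union> fst ` U \<union> snd ` U"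
  have "small ?X" using assms(1) by (intro small_Un small_image small_finite[of "{d x}"]) auto
  moreover have "?X \<subseteq> K"
  proof -
    have "d x \<in> K" using d assms(3) K0 le_in_K by blast
    moreover have "d (hi e) \<in> K \<and> fst e \<in> K \<and> snd e \<in> K" if "e \<in> U" for e
      using good_edgeD[of e] that assms(2) le_in_K by (auto simp: sparse_def)
    ultimately show ?thesis by blast
  qed
  moreover have "{y \<in> K0. col y = col x} \<subseteq> K" using K0 by blast
  ultimately obtain t where t: "t \<in> {y \<in> K0. col y = col x}" "\<And>z. z \<in> ?X \<Longrightarrow> z \<prec> t"
    using not_small_unbounded[OF large[OF assms(3)]] by blast
  show thesis
  proof (rule that[of t])
    show "d (hi e) \<prec> t \<and> fst e \<prec> t \<and> snd e \<prec> t" if "e \<in> U" for e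
      using t(2) that by blast
  qed (use t in auto)
qed

text \<open>The new edge leads from \<open>x\<close> up to a fresh point. Only its upper end has to
  be new; \<open>x\<close> may already occur in the range of \<open>U\<close>.\<close>

lemma extend_domain:
  assumes "small U" "sparse U" "x \<in> K0"
  obtains V where "U \<subseteq> V" "small V" "sparse V" "x \<in> Domain V"
proof (cases "x \<in> Domain U")
  case False
  obtain t where t: "t \<in> K0" "col t = col x" "d x \<prec> t"
    "\<And>e. e \<in> U \<Longrightarrow> d (hi e) \<prec> t \<and> fst e \<prec> t \<and> snd e \<prec> t"
    using fresh_hi[OF assms] by blast
  have "x \<prec> t" using d t(3) assms(3) K0 le_lt_trans by blast
  then have tb: "hi (x, t) = t" "lo (x, t) = x" by (rule hi_lo_upward)+
  have "sparse {(x, t)}" using t assms(3) tb by (simp add: sparse_def good_edge_def)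
  then have "sparse (U \<union> {(x, t)})"
  proof (rule sparse_Un[OF assms(2)])
    fix e e' assume e: "e \<in> U" "e' \<in> {(x, t)}"
    then have "fst e \<noteq> x" using False by (metis Domain.DomainI prod.collapse)
    then show "fst e \<noteq> fst e' \<and> snd e \<noteq> snd e' \<and> d (hi e) \<prec> hi e'"
      using e tb t(4)[OF e(1)] lt_irrefl by auto
  qed
  moreover have "small (U \<union> {(x, t)})" using small_Un[OF assms(1) small_finite] by blast
  ultimately show thesis using that[of "U \<union> {(x, t)}"] by auto
qed (use that assms in blast)

lemma extend_range:
  assumes "small U" "sparse U" "x \<in> K0"
  obtains V where "U \<subseteq> V" "small V" "sparse V" "x \<in> Range V"
proof (cases "x \<in> Range U")
  case False
  obtain t where t: "t \<in> K0" "col t = col x" "d x \<prec> t"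
    "\<And>e. e \<in> U \<Longrightarrow> d (hi e) \<prec> t \<and> fst e \<prec> t \<and> snd e \<prec> t"
    using fresh_hi[OF assms] by blast
  have "x \<prec> t" using d t(3) assms(3) K0 le_lt_trans by blast
  then have tb: "hi (t, x) = t" "lo (t, x) = x" by (rule hi_lo_upward)+
  have "sparse {(t, x)}" using t assms(3) tb by (simp add: sparse_def good_edge_def)
  then have "sparse (U \<union> {(t, x)})"
  proof (rule sparse_Un[OF assms(2)])
    fix e e' assume e: "e \<in> U" "e' \<in> {(t, x)}"
    then have "snd e \<noteq> x" using False by (metis Range.RangeI prod.collapse)
    then show "fst e \<noteq> fst e' \<and> snd e \<noteq> snd e' \<and> d (hi e) \<prec> hi e'"
      using e tb t(4)[OF e(1)] lt_irrefl by auto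
  qed
  moreover have "small (U \<union> {(t, x)})" using small_Un[OF assms(1) small_finite] by blast
  ultimately show thesis using that[of "U \<union> {(t, x)}"] by auto
qed (use that assms in blast)

definition beyond :: "'a \<Rightarrow> ('a \<times> 'a) set \<Rightarrow> bool" where
  "beyond b r \<longleftrightarrow> (\<forall>e\<in>r. b \<prec> fst e \<and> b \<prec> snd e)"

text \<open>Members of \<open>R\<close> occur arbitrarily high, so one of them lies beyond
  everything that \<open>U\<close> involves.\<close>

lemma extend_prescribed:
  assumes "small U" "sparse U" "b \<in> K"
    and R: "\<And>r. r \<in> R \<Longrightarrow> small r \<and> sparse r" "\<And>b. b \<in> K \<Longrightarrow> \<exists>r\<in>R. beyond b r"
  obtains V r where "U \<subseteq> V" "small V" "sparse V" "r \<in> R" "r \<subseteq> V" "beyond b r"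
proof -
  let ?X = "{b} \<union> (\<lambda>e. d (hi e)) ` U \<union> fst ` U \<union> snd ` U"
  have "small ?X" using assms(1) by (intro small_Un small_image small_finite[of "{b}"]) auto
  moreover have "?X \<subseteq> K"
  proof -
    have "d (hi e) \<in> K \<and> fst e \<in> K \<and> snd e \<in> K" if "e \<in> U" for e
      using good_edgeD[of e] that assms(2) le_in_K by (auto simp: sparse_def)
    then show ?thesis using assms(3) by blast
  qed
  ultimately obtain c where c: "c \<in> K" "\<And>z. z \<in> ?X \<Longrightarrow> z \<prec> c"
    using small_bounded by blast
  then obtain r where r: "r \<in> R" "beyond c r" using R(2) by blast
  have "sparse (U \<union> r)"
  proof (rule sparse_Un[OF assms(2)])
    show "sparse r" using R(1) r by blast
    fix e e' assume e: "e \<in> U" "e' \<in> r"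
    have "fst e \<prec> c" "snd e \<prec> c" "d (hi e) \<prec> c" using c(2) e(1) by auto
    moreover have "c \<prec> fst e'" "c \<prec> snd e'" using r(2) e(2) by (auto simp: beyond_def)
    ultimately show "fst e \<noteq> fst e' \<and> snd e \<noteq> snd e' \<and> d (hi e) \<prec> hi e'"
      using lt_trans lt_irrefl hi_lo_cases[of e'] by metis
  qed
  moreover have "small (U \<union> r)" using small_Un[OF assms(1)] R(1) r by blast
  moreover have "beyond b r" using r(2) c(2)[of b] lt_trans unfolding beyond_def by blast
  ultimately show thesis using that[of "U \<union> r" r] r by blast
qed

lemma sparse_chain_Union:
  assumes "\<And>U. U \<in> C \<Longrightarrow> sparse U" "\<And>U V. U \<in> C \<Longrightarrow> V \<in> C \<Longrightarrow> U \<subseteq> V \<or> V \<subseteq> U"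
  shows "sparse (\<Union>C)"
  unfolding sparse_def
proof (intro conjI ballI impI)
  fix e assume "e \<in> \<Union>C"
  then show "good_edge e" using assms(1) by (auto simp: sparse_def)
next
  fix e e' assume "e \<in> \<Union>C" "e' \<in> \<Union>C" "e \<noteq> e'"
  moreover from this obtain U where "U \<in> C" "e \<in> U" "e' \<in> U" using assms(2) by blast
  ultimately show "compatible e e'" using assms(1) by (auto simp: sparse_def)
qed

text \<open>This is a back-and-forth recursion of length \<kappa>. Stage \<open>x\<close> puts
  \<open>x\<close> into domain and range if it is in \<open>K0\<close>, and adds a member of
  \<open>R\<close> beyond \<open>x\<close>. Each stage is small, because by regularity the union of
  the earlier ones is.\<close>

lemma exists_sparse_total:
  assumes R: "\<And>r. r \<in> R \<Longrightarrow> small r \<and> sparse r" "\<And>b. b \<in> K \<Longrightarrow> \<exists>r\<in>R. beyond b r"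
  obtains E where "sparse E" "K0 \<subseteq> Domain E" "K0 \<subseteq> Range E"
    "\<forall>b\<in>K. \<exists>r\<in>R. beyond b r \<and> r \<subseteq> E"
proof -
  \<comment> \<open>The recursion runs over the whole type; outside \<open>K\<close> nothing is
    demanded.\<close>
  define P where "P f x V \<longleftrightarrow> (x \<in> K \<longrightarrow> small V \<and> sparse V \<and> (\<forall>y. y \<prec> x \<longrightarrow> f y \<subseteq> V) \<and>
      (x \<in> K0 \<longrightarrow> x \<in> Domain V \<and> x \<in> Range V) \<and> (\<exists>r\<in>R. beyond x r \<and> r \<subseteq> V))"
    for f :: "'a \<Rightarrow> ('a \<times> 'a) set" and x V
  have "\<exists>f. \<forall>x. P f x (f x)"
  proof (rule dependent_wf_choice[OF wf_lt])
    show "P f x V = P g x V" if "\<And>z. (z, x) \<in> {(x, y). x \<prec> y} \<Longrightarrow> f z = g z" for f g x V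
      using that unfolding P_def by simp
  next
    fix x f assume "\<And>y. (y, x) \<in> {(x, y). x \<prec> y} \<Longrightarrow> P f y (f y)"
    then have IH: "P f y (f y)" if "y \<prec> x" for y using that by simp
    show "\<exists>V. P f x V"
    proof (cases "x \<in> K")
      case True
      let ?U = "\<Union> (f ` {y. y \<prec> x})"
      have IH': "small (f y) \<and> sparse (f y) \<and> (\<forall>z. z \<prec> y \<longrightarrow> f z \<subseteq> f y)" if "y \<prec> x" for y
        using IH[OF that] lt_in_K[OF that] unfolding P_def by blast
      have U0: "small ?U" using IH' small_below[OF True] by (intro small_UN) auto
      have U1: "sparse ?U"
      proof (rule sparse_chain_Union)
        show "sparse V" if "V \<in> f ` {y. y \<prec> x}" for V using that IH' by blast
        fix V W assume "V \<in> f ` {y. y \<prec> x}" "W \<in> f ` {y. y \<prec> x}"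
        then obtain y z where yz: "V = f y" "W = f z" "y \<prec> x" "z \<prec> x" by blast
        then consider "y = z" | "y \<prec> z" | "z \<prec> y" using not_lt lt_in_K lt_iff by metis
        then show "V \<subseteq> W \<or> W \<subseteq> V" using IH' yz by cases auto
      qed
      obtain V1 r where V1: "?U \<subseteq> V1" "small V1" "sparse V1" "r \<in> R" "r \<subseteq> V1" "beyond x r"
        by (rule extend_prescribed[OF U0 U1 True R])
      obtain V2 where V2: "V1 \<subseteq> V2" "small V2" "sparse V2" "x \<in> K0 \<longrightarrow> x \<in> Domain V2"
        using extend_domain[OF V1(2,3), of x] V1(2,3) by (metis subset_refl)
      obtain V3 where V3: "V2 \<subseteq> V3" "small V3" "sparse V3" "x \<in> K0 \<longrightarrow> x \<in> Range V3"
        using extend_range[OF V2(2,3), of x] V2(2,3) by (metis subset_refl)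
      have "P f x V3" unfolding P_def
      proof (intro impI conjI)
        show "\<forall>y. y \<prec> x \<longrightarrow> f y \<subseteq> V3" using V1(1) V2(1) V3(1) by blast
        show "x \<in> Domain V3" if "x \<in> K0" using that V2(4) V3(1) by blast
        show "\<exists>r\<in>R. beyond x r \<and> r \<subseteq> V3" using V1(4-6) V2(1) V3(1) by blast
      qed (use V3 in auto)
      then show ?thesis by blast
    qed (simp add: P_def)
  qed
  then obtain f where f: "\<And>x. P f x (f x)" by blast
  have f1: "sparse (f x)" "\<And>y. y \<prec> x \<Longrightarrow> f y \<subseteq> f x" "\<exists>r\<in>R. beyond x r \<and> r \<subseteq> f x"
    if "x \<in> K" for x using f[of x] that unfolding P_def by blast+
  have f2: "x \<in> Domain (f x)" "x \<in> Range (f x)" if "x \<in> K0" for x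
    using f[of x] that K0 unfolding P_def by blast+
  show thesis
  proof (rule that[of "\<Union> (f ` K)"])
    show "sparse (\<Union> (f ` K))"
    proof (rule sparse_chain_Union)
      show "sparse V" if "V \<in> f ` K" for V using that f1 by blast
      fix V W assume "V \<in> f ` K" "W \<in> f ` K"
      then obtain y z where yz: "V = f y" "W = f z" "y \<in> K" "z \<in> K" by blast
      then consider "y = z" | "y \<prec> z" | "z \<prec> y" using not_lt lt_iff by metis
      then show "V \<subseteq> W \<or> W \<subseteq> V" using f1(2) yz by cases auto
    qed
    show "K0 \<subseteq> Domain (\<Union> (f ` K))" using f2(1) K0 by blast
    show "K0 \<subseteq> Range (\<Union> (f ` K))" using f2(2) K0 by blast
    show "\<forall>b\<in>K. \<exists>r\<in>R. beyond b r \<and> r \<subseteq> \<Union> (f ` K)"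
      using f1(3) by blast
  qed
qed

lemma exists_sparse_permutation:
  assumes R: "\<And>r. r \<in> R \<Longrightarrow> small r \<and> sparse r" "\<And>b. b \<in> K \<Longrightarrow> \<exists>r\<in>R. beyond b r"
    and s: "bij_betw s (K - K0) (K - K0)" "\<And>x. x \<in> K - K0 \<Longrightarrow> col (s x) = col x"
  obtains g where "g \<in> Bij K" "\<And>x. x \<in> K \<Longrightarrow> col (g x) = col x"
    "\<And>x. x \<in> K - K0 \<Longrightarrow> g x = s x" "\<And>x. x \<in> K0 \<Longrightarrow> g x \<in> K0"
    "sparse ((\<lambda>x. (x, g x)) ` K0)"
    "\<And>b. b \<in> K \<Longrightarrow> \<exists>r\<in>R. beyond b r \<and> r \<subseteq> (\<lambda>x. (x, g x)) ` K0"
proof -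
  obtain E where E: "sparse E" "K0 \<subseteq> Domain E" "K0 \<subseteq> Range E"
    "\<forall>b\<in>K. \<exists>r\<in>R. beyond b r \<and> r \<subseteq> E"
    by (rule exists_sparse_total[OF R])
  have "\<exists>y. (x, y) \<in> E" if "x \<in> K0" for x using E(2) that by blast
  then obtain e where e: "\<And>x. x \<in> K0 \<Longrightarrow> (x, e x) \<in> E" by metis
  have EK: "x \<in> K0" "y \<in> K0" "col x = col y" if "(x, y) \<in> E" for x y
    using that E(1) unfolding sparse_def good_edge_def by fastforce+
  have fst: "y = y'" if "(x, y) \<in> E" "(x, y') \<in> E" for x y y'
    using that E(1) unfolding sparse_def compatible_def by fastforce
  have snd: "x = x'" if "(x, y) \<in> E" "(x', y) \<in> E" for x x' y
    using that E(1) unfolding sparse_def compatible_def by fastforce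
  \<comment> \<open>The value outside \<open>K\<close> makes \<open>g\<close> extensional, as
    \<open>Bij\<close> requires.\<close>
  define g where "g x = (if x \<in> K0 then e x else if x \<in> K then s x else undefined)" for x
  have Eg: "E = (\<lambda>x. (x, g x)) ` K0"
    using e EK fst unfolding g_def by (auto simp: image_iff)
  have b0: "bij_betw g K0 K0"
  proof (rule bij_betwI')
    show "g x = g y \<longleftrightarrow> x = y" if "x \<in> K0" "y \<in> K0" for x y
      using that snd[OF e, of x y] e[of y] by (auto simp: g_def)
    show "g x \<in> K0" if "x \<in> K0" for x using that EK(2)[OF e] by (simp add: g_def)
    show "\<exists>x\<in>K0. y = g x" if "y \<in> K0" for y using that E(3) Eg by auto
  qed
  have "bij_betw g (K - K0) (K - K0)"
    using s(1) by (subst bij_betw_cong[of _ _ s]) (auto simp: g_def)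
  from bij_betw_combine[OF b0 this] have "bij_betw g K K"
    using K0 by (simp add: Un_absorb1 Un_commute)
  moreover have "g \<in> extensional K" using K0 by (auto simp: g_def extensional_def)
  ultimately have "g \<in> Bij K" by (simp add: Bij_def)
  moreover have "col (g x) = col x" if "x \<in> K" for x
    using that s(2) EK(3)[OF e, of x] by (auto simp: g_def)
  moreover have "g x = s x" if "x \<in> K - K0" for x using that by (simp add: g_def)
  moreover have "g x \<in> K0" if "x \<in> K0" for x using b0 that by (auto simp: bij_betw_def)
  ultimately show thesis using that E(1,4) unfolding Eg by blast
qed

text \<open>Different edges have different upper ends, so \<open>hi e\<close> can only be the lower
  end of \<open>e'\<close>.\<close>

lemma shared_endpoint_less:
  assumes E: "sparse E" "e \<in> E" "e' \<in> E" "e \<noteq> e'" and p: "hi e = fst e' \<or> hi e = snd e'"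
  shows "hi e \<prec> hi e'"
proof -
  have ge: "good_edge e" "good_edge e'" "hi e \<noteq> hi e'"
    using E by (auto simp: sparse_def compatible_def)
  then have "lo e' = hi e" using p hi_lo_cases[of e'] by metis
  then show ?thesis using ge good_edgeD(5)[OF ge(1)] le_lt_trans unfolding good_edge_def by metis
qed

text \<open>As \<open>p\<close> is not an upper end, it is the lower end of \<open>e'\<close>, and
  \<open>hi e'\<close> lies beyond \<open>d p\<close>.\<close>

lemma near_endpoint_less:
  assumes E: "sparse E" "e' \<in> E" "p = fst e' \<or> p = snd e'" and p: "p \<notin> hi ` E" "t \<preceq> d p"
  shows "t \<prec> hi e'"
proof -
  have "lo e' = p" using E(2,3) p(1) hi_lo_cases[of e'] by (metis imageI)
  then show ?thesis using E p(2) le_lt_trans unfolding sparse_def good_edge_def by metis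
qed

text \<open>The edge of a closed path with the highest upper end is entered or left through that end, and
  either way a neighbouring edge would reach higher.\<close>

lemma no_closed_path:
  assumes n: "n > 0" and K: "\<And>i. i < n \<Longrightarrow> hi (ed i) \<in> K"
    and ends: "\<And>i. i < n \<Longrightarrow> hi (ed i) = q i \<or> hi (ed i) = r i"
    and up: "\<And>i. i < n \<Longrightarrow> hi (ed i) = q i \<Longrightarrow> hi (ed i) \<prec> hi (ed (Suc i mod n))"
    and down: "\<And>i. i < n \<Longrightarrow> hi (ed (Suc i mod n)) = r (Suc i mod n) \<Longrightarrow>
                 hi (ed (Suc i mod n)) \<prec> hi (ed i)"
  shows False
proof -
  have "\<exists>m\<in>(\<lambda>i. hi (ed i)) ` {..<n}. \<forall>x\<in>(\<lambda>i. hi (ed i)) ` {..<n}. x \<preceq> m"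
    using n K by (intro finite_has_max) auto
  then obtain m where m: "m < n" "\<And>i. i < n \<Longrightarrow> hi (ed i) \<preceq> hi (ed m)" by auto
  have contr: False if "i < n" "hi (ed m) \<prec> hi (ed i)" for i
    using m(2)[OF that(1)] that(2) le_lt_trans lt_irrefl by blast
  have "Suc m mod n < n" using n by simp
  moreover obtain j where j: "j < n" "Suc j mod n = m"
  proof (cases m)
    case 0
    then show thesis using that[of "n - 1"] n by simp
  next
    case (Suc k)
    then show thesis using that[of k] m(1) by simp
  qed
  ultimately show False using ends[OF m(1)] up[OF m(1)] down[OF j(1)] contr j by metis
qed

section \<open>Fixed points of words in the new permutation\<close>

context
  fixes G :: "('a \<Rightarrow> 'a) set" and g :: "'a \<Rightarrow> 'a"
  assumes G: "subgroup G (BijGroup K)" and g: "g \<in> Bij K"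
    and S: "small (K - K0)" and sp: "sparse ((\<lambda>x. (x, g x)) ` K0)"
    and dom: "\<And>a. a \<in> G \<Longrightarrow> small {x \<in> K. \<not> a x \<preceq> d x}"
    and cof: "\<And>a. a \<in> G \<Longrightarrow> a \<noteq> \<one>\<^bsub>BijGroup K\<^esub> \<Longrightarrow> small {x \<in> K. a x = x}"
    and spread: "\<And>a. a \<in> G \<Longrightarrow> a \<noteq> \<one>\<^bsub>BijGroup K\<^esub> \<Longrightarrow>
      small {t \<in> K. a t \<noteq> t \<and> (\<exists>r\<in>R. \<exists>e\<in>r. \<exists>e'\<in>r. t = hi e \<and> a t = hi e')}"
begin

interpretation Bij: group "BijGroup K" by (rule group_BijGroup)

lemma G_Bij: "a \<in> G \<Longrightarrow> a \<in> Bij K"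
  using subgroup.mem_carrier[OF G] by simp

definition graph :: "('a \<times> 'a) set" where
  "graph = (\<lambda>x. (x, g x)) ` K0"

text \<open>These are the points at which applying \<open>a\<close> might let a path turn at an
  upper end. For the identity every upper end would qualify; there cyclic reducedness takes over,
  and the set is declared empty.\<close>

definition exceptional :: "('a \<Rightarrow> 'a) \<Rightarrow> 'a set" where
  "exceptional a = (if a = \<one>\<^bsub>BijGroup K\<^esub> then {}
     else {t \<in> K. \<not> t \<preceq> d (a t) \<or> t \<in> hi ` graph \<and> a t \<in> hi ` graph})"

text \<open>If \<open>t\<close> is not below \<open>d (a t)\<close>, the inverse of \<open>a\<close>
  escapes domination at \<open>a t\<close>. Otherwise \<open>t\<close> and \<open>a t\<close> are
  upper ends: either \<open>a\<close> fixes \<open>t\<close>, or \<open>a\<close> escapes domination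
  at \<open>t\<close>, or the two ends are close, so that their edges share a member of
  \<open>R\<close> and \<open>spread\<close> applies.\<close>

lemma small_exceptional:
  assumes a: "a \<in> G"
  shows "small (exceptional a)"
proof (cases "a = \<one>\<^bsub>BijGroup K\<^esub>")
  case True
  then show ?thesis by (simp add: exceptional_def small_finite)
next
  case False
  note aK = G_Bij[OF a]
  let ?i = "inv\<^bsub>BijGroup K\<^esub> a"
  have i: "?i \<in> G" using a subgroup.m_inv_closed[OF G] by blast
  let ?B1 = "{t \<in> K. a t \<in> {y \<in> K. \<not> ?i y \<preceq> d y}}" and ?B2 = "{t \<in> K. \<not> a t \<preceq> d t}"
    and ?B3 = "{t \<in> K. a t = t}"
    and ?B4 = "{t \<in> K. a t \<noteq> t \<and> (\<exists>r\<in>R. \<exists>e\<in>r. \<exists>e'\<in>r. t = hi e \<and> a t = hi e')}"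
  have "exceptional a \<subseteq> (?B1 \<union> ?B2) \<union> (?B3 \<union> ?B4)"
  proof
    fix t assume "t \<in> exceptional a"
    then have t: "t \<in> K" "\<not> t \<preceq> d (a t) \<or> t \<in> hi ` graph \<and> a t \<in> hi ` graph"
      using False by (auto simp: exceptional_def)
    show "t \<in> (?B1 \<union> ?B2) \<union> (?B3 \<union> ?B4)"
    proof (cases "\<not> t \<preceq> d (a t)")
      case True
      then have "t \<in> ?B1" using t(1) BijGroup_inv_app[OF aK t(1)] Bij_app[OF aK t(1)] by simp
      then show ?thesis by blast
    next
      case F: False
      then obtain e e' where e: "e \<in> graph" "e' \<in> graph" "t = hi e" "a t = hi e'" using t(2) by blast
      have "t \<in> ?B4" if "a t \<noteq> t" "a t \<preceq> d t"
      proof -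
        have "e \<noteq> e'" using that(1) e(3,4) by auto
        then have "compatible e e'" using sp e(1,2) unfolding graph_def sparse_def by blast
        then have "\<exists>r\<in>R. e \<in> r \<and> e' \<in> r" using F that(2) e(3,4) unfolding compatible_def by metis
        then show ?thesis using that(1) t(1) e(3,4) by blast
      qed
      then show ?thesis using t(1) by blast
    qed
  qed
  moreover have "small ((?B1 \<union> ?B2) \<union> (?B3 \<union> ?B4))"
    by (intro small_Un small_Bij_preimage[OF aK dom[OF i]] dom[OF a] cof[OF a False] spread[OF a False])
  ultimately show ?thesis by (rule small_subset[rotated])
qed

lemma exceptional_link:
  assumes a: "a \<in> G" "a \<noteq> \<one>\<^bsub>BijGroup K\<^esub>" and e: "e \<in> graph" "e' \<in> graph"
    and t: "hi e \<notin> exceptional a" "a (hi e) = fst e' \<or> a (hi e) = snd e'"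
  shows "hi e \<prec> hi e'"
proof (rule near_endpoint_less)
  show "sparse graph" "e' \<in> graph" "a (hi e) = fst e' \<or> a (hi e) = snd e'"
    using sp e t by (simp_all add: graph_def)
  have "hi e \<in> K" using sp e(1) good_edgeD(3) unfolding graph_def sparse_def by blast
  then show "a (hi e) \<notin> hi ` graph" "hi e \<preceq> d (a (hi e))"
    using t(1) a(2) e(1) by (auto simp: exceptional_def)
qed

text \<open>A fixed point traces a closed path of edges of \<open>g\<close> linked by the
  coefficients. By \<open>no_closed_path\<close> the path must meet the small set \<open>B\<close>,
  and so the fixed points lie in finitely many preimages of \<open>B\<close> under
  bijections.\<close>

lemma small_fixpoints_word:
  assumes w: "w \<noteq> []" "snd ` set w \<subseteq> G" "cyclically_reduced (BijGroup K) w"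
  shows "small {p \<in> K. word_val (BijGroup K) g w p = p}"
proof -
  let ?G = "BijGroup K"
  define n where "n = length w"
  define a where "a i = snd (w ! i)" for i
  define e where "e i = fst (w ! i)" for i
  define y where "y i = (if e i then g else inv\<^bsub>?G\<^esub> g)" for i
  \<comment> \<open>Words act from the right: \<open>q i p\<close> is the point just before letter
    \<open>i\<close> acts, and \<open>r i p\<close> the point just after.\<close>
  define r where "r i = word_val ?G g (drop i w)" for i
  define q where "q i = a i \<otimes>\<^bsub>?G\<^esub> r (Suc i)" for i
  have n: "n > 0" using w(1) by (simp add: n_def)
  have aG: "a i \<in> G" if "i < n" for i
    using that w(2) nth_mem[of i w] by (auto simp: a_def n_def)
  have aiG: "inv\<^bsub>?G\<^esub> (a i) \<in> G" if "i < n" for i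
    using aG[OF that] subgroup.m_inv_closed[OF G] by blast
  have rB: "r i \<in> Bij K" for i
  proof -
    have "snd ` set (drop i w) \<subseteq> carrier ?G"
      using w(2) G_Bij set_drop_subset[of i w] by fastforce
    then show ?thesis using Bij.word_val_closed[of g "drop i w"] g by (simp add: r_def)
  qed
  have qB: "q i \<in> Bij K" if "i < n" for i
    using Bij.m_closed[of "a i" "r (Suc i)"] G_Bij[OF aG[OF that]] rB by (simp add: q_def)
  have yB: "y i \<in> Bij K" for i using g BijGroup_inv_closed[OF g] by (simp add: y_def)
  have step: "r i = y i \<otimes>\<^bsub>?G\<^esub> q i" if "i < n" for i
  proof -
    have "drop i w = (e i, a i) # drop (Suc i) w"
      using that by (simp add: Cons_nth_drop_Suc e_def a_def n_def)
    then show ?thesis by (simp add: r_def q_def y_def)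
  qed
  \<comment> \<open>Both \<open>a i\<close> and its inverse occur, because the link between two
    consecutive edges is followed from whichever side has the upper end.\<close>
  define B where "B = (K - K0) \<union> (\<Union>i\<in>{..<n}. exceptional (a i) \<union> exceptional (inv\<^bsub>?G\<^esub> (a i)))"
  have "small B" unfolding B_def
    using small_exceptional[OF aG] small_exceptional[OF aiG]
    by (intro small_Un[OF S] small_UN[OF small_finite[OF finite_lessThan]] small_Un) auto
  have "\<exists>i\<in>{..<n}. q i p \<in> B \<or> r i p \<in> B" if p: "p \<in> K" "r 0 p = p" for p
  proof (rule ccontr)
    assume "\<not> (\<exists>i\<in>{..<n}. q i p \<in> B \<or> r i p \<in> B)"
    then have nB: "q i p \<notin> B" "r i p \<notin> B" if "i < n" for i using that by blast+
    have qrK: "q i p \<in> K0" "r i p \<in> K0" "q i p \<in> K" "r i p \<in> K" if "i < n" for i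
      using nB[OF that] Bij_app[OF qB[OF that] p(1)] Bij_app[OF rB p(1)] by (auto simp: B_def)
    \<comment> \<open>The edge is oriented along \<open>g\<close>, also where the path runs through
      it by the inverse of \<open>g\<close>.\<close>
    define ed where "ed i = (if e i then (q i p, r i p) else (r i p, q i p))" for i
    have rq: "r i p = y i (q i p)" if "i < n" for i
      using step[OF that] BijGroup_mult_app[OF yB qB[OF that] p(1)] by simp
    have "r n p = p" using BijGroup_one_app[OF p(1)] by (simp add: r_def n_def)
    \<comment> \<open>The path closes up since \<open>p\<close> is a fixed point, so positions can
      be counted modulo \<open>n\<close>.\<close>
    then have rSuc: "r (Suc i) p = r (Suc i mod n) p" if "i < n" for i
      using that p(2) by (cases "Suc i = n") auto
    have qr: "q i p = a i (r (Suc i mod n) p)" if "i < n" for i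
      using rSuc[OF that] BijGroup_mult_app[OF G_Bij[OF aG[OF that]] rB p(1)] by (simp add: q_def)
    have rq': "r (Suc i mod n) p = (inv\<^bsub>?G\<^esub> (a i)) (q i p)" if "i < n" for i
      using qr[OF that] BijGroup_inv_app(1)[OF G_Bij[OF aG[OF that]]] Bij_app[OF rB p(1)] by simp
    have ed: "ed i \<in> graph" if "i < n" for i
    proof (cases "e i")
      case True
      then show ?thesis using rq[OF that] qrK[OF that] by (simp add: ed_def y_def graph_def)
    next
      case False
      then have "g (r i p) = q i p"
        using rq[OF that] BijGroup_inv_app(2)[OF g qrK(3)[OF that]] by (simp add: y_def)
      then show ?thesis using False qrK[OF that] unfolding ed_def graph_def by (auto simp: image_iff)
    qed
    have hiq: "hi (ed i) = q i p \<or> hi (ed i) = r i p" for i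
      using hi_lo_cases[of "ed i"] by (auto simp: ed_def split: if_splits)
    have ends: "fst (ed i) = q i p \<or> snd (ed i) = q i p" "fst (ed i) = r i p \<or> snd (ed i) = r i p" for i
      by (auto simp: ed_def)
    have spg: "sparse graph" using sp by (simp add: graph_def)
    have ne: "q i p \<noteq> r i p" if "i < n" for i
    proof
      assume eq: "q i p = r i p"
      have ge: "good_edge (ed i)" using spg ed[OF that] by (auto simp: sparse_def)
      have "hi (ed i) = lo (ed i)" using hi_lo_cases[of "ed i"] eq by (auto simp: ed_def split: if_splits)
      then show False
        using ge good_edgeD(5)[OF ge] le_lt_trans lt_irrefl unfolding good_edge_def by metis
    qed
    \<comment> \<open>Across a trivial coefficient the two letters have equal sign. If their edges
      coincided, then \<open>q i p = r i p\<close> would follow, against \<open>ne\<close>.\<close>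
    have triv: "q i p = r (Suc i mod n) p" "ed i \<noteq> ed (Suc i mod n)"
      if "i < n" "a i = \<one>\<^bsub>?G\<^esub>" for i
    proof -
      show 1: "q i p = r (Suc i mod n) p"
        using qr[OF that(1)] that(2) BijGroup_one_app[OF Bij_app[OF rB p(1)]] by simp
      have "e i = e (Suc i mod n)"
        using w(3) that unfolding cyclically_reduced_def e_def a_def n_def by blast
      then show "ed i \<noteq> ed (Suc i mod n)"
        using 1 ne[OF that(1)] by (auto simp: ed_def)
    qed
    show False
    proof (rule no_closed_path[where ed = ed and q = "\<lambda>i. q i p" and r = "\<lambda>i. r i p", OF n])
      show "hi (ed i) \<in> K" if "i < n" for i using hiq[of i] qrK[OF that] by auto
      show "hi (ed i) = q i p \<or> hi (ed i) = r i p" for i by (rule hiq)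
      fix i assume i: "i < n"
      let ?j = "Suc i mod n"
      have j: "?j < n" using n by simp
      have exB: "exceptional (a i) \<subseteq> B" "exceptional (inv\<^bsub>?G\<^esub> (a i)) \<subseteq> B"
        using i unfolding B_def by blast+
      show "hi (ed i) \<prec> hi (ed ?j)" if hi: "hi (ed i) = q i p"
      proof (cases "a i = \<one>\<^bsub>?G\<^esub>")
        case True
        show ?thesis using shared_endpoint_less[OF spg ed[OF i] ed[OF j] triv(2)[OF i True]]
            hi triv(1)[OF i True] ends(2)[of ?j] by metis
      next
        case False
        have "inv\<^bsub>?G\<^esub> (a i) \<noteq> \<one>\<^bsub>?G\<^esub>"
          using False Bij.inv_eq_1_iff[of "a i"] G_Bij[OF aG[OF i]] by simp
        then show ?thesis using exceptional_link[OF aiG[OF i] _ ed[OF i] ed[OF j]]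
            hi nB(1)[OF i] exB(2) rq'[OF i] ends(2)[of ?j] by (metis subsetD)
      qed
      show "hi (ed ?j) \<prec> hi (ed i)" if hi: "hi (ed ?j) = r ?j p"
      proof (cases "a i = \<one>\<^bsub>?G\<^esub>")
        case True
        show ?thesis
          using shared_endpoint_less[OF spg ed[OF j] ed[OF i] triv(2)[OF i True, symmetric]]
            hi triv(1)[OF i True] ends(1)[of i] by metis
      next
        case False
        then show ?thesis using exceptional_link[OF aG[OF i] _ ed[OF j] ed[OF i]]
            hi nB(2)[OF j] exB(1) qr[OF i] ends(1)[of i] by (metis subsetD)
      qed
    qed
  qed
  then have "{p \<in> K. r 0 p = p} \<subseteq> (\<Union>i\<in>{..<n}. {p \<in> K. q i p \<in> B} \<union> {p \<in> K. r i p \<in> B})"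
    by blast
  moreover have "small (\<Union>i\<in>{..<n}. {p \<in> K. q i p \<in> B} \<union> {p \<in> K. r i p \<in> B})"
    using small_Bij_preimage[OF qB \<open>small B\<close>] small_Bij_preimage[OF rB \<open>small B\<close>]
    by (intro small_UN[OF small_finite[OF finite_lessThan]] small_Un) auto
  ultimately show ?thesis using small_subset by (simp add: r_def)
qed

text \<open>Conjugation carries fixed points to fixed points bijectively, so it is enough to treat a
  conjugate in \<open>G\<close> or one given by a cyclically reduced word.\<close>

lemma small_fixpoints_generate:
  assumes u: "u \<in> generate (BijGroup K) (insert g G)" "u \<noteq> \<one>\<^bsub>BijGroup K\<^esub>"
  shows "small {x \<in> K. u x = x}"
proof -
  let ?G = "BijGroup K"
  have gen: "insert g G \<subseteq> carrier ?G" using g G_Bij by auto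
  have uB: "u \<in> Bij K" using Bij.generate_in_carrier[OF gen u(1)] by simp
  have conj: "small {x \<in> K. u x = x}"
    if c: "c \<in> carrier ?G" and v: "small {x \<in> K. (c \<otimes>\<^bsub>?G\<^esub> u \<otimes>\<^bsub>?G\<^esub> inv\<^bsub>?G\<^esub> c) x = x}" for c
  proof -
    let ?v = "c \<otimes>\<^bsub>?G\<^esub> u \<otimes>\<^bsub>?G\<^esub> inv\<^bsub>?G\<^esub> c"
    have cB: "c \<in> Bij K" "inv\<^bsub>?G\<^esub> c \<in> Bij K" "c \<otimes>\<^bsub>?G\<^esub> u \<in> Bij K"
      using c uB Bij.inv_closed[OF c] Bij.m_closed[OF c, of u] by simp_all
    have "?v (c x) = c x" if "x \<in> K" "u x = x" for x
      using BijGroup_mult_app[OF cB(3,2) Bij_app[OF cB(1) that(1)]] that(2)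
        BijGroup_inv_app(1)[OF cB(1) that(1)] BijGroup_mult_app[OF cB(1) uB that(1)] by simp
    then have "{x \<in> K. u x = x} \<subseteq> {x \<in> K. c x \<in> {x \<in> K. ?v x = x}}"
      using Bij_app[OF cB(1)] by blast
    then show ?thesis using small_Bij_preimage[OF cB(1) v] small_subset by blast
  qed
  have "g \<in> carrier ?G" using g by simp
  from Bij.conjugate_cyclically_reduced[OF G this u(1)] show ?thesis
  proof cases
    case (1 c)
    have "c \<otimes>\<^bsub>?G\<^esub> u \<otimes>\<^bsub>?G\<^esub> inv\<^bsub>?G\<^esub> c \<noteq> \<one>\<^bsub>?G\<^esub>"
    proof
      assume "c \<otimes>\<^bsub>?G\<^esub> u \<otimes>\<^bsub>?G\<^esub> inv\<^bsub>?G\<^esub> c = \<one>\<^bsub>?G\<^esub>"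
      then have "inv\<^bsub>?G\<^esub> (inv\<^bsub>?G\<^esub> c) = c \<otimes>\<^bsub>?G\<^esub> u"
        using 1(1) uB BijGroup_inv_closed[of c K] Bij.m_closed[of c u]
        by (intro Bij.inv_equality) simp_all
      then have "c \<otimes>\<^bsub>?G\<^esub> u = c" using Bij.inv_inv[OF 1(1)] by simp
      then show False using Bij.l_cancel_one[OF 1(1), of u] uB u(2) by simp
    qed
    then show ?thesis using conj[OF 1(1)] cof[OF 1(2)] by blast
  next
    case (2 c w)
    then show ?thesis using conj[OF 2(1)] small_fixpoints_word[OF 2(2-4)] by simp
  qed
qed

end

end

section \<open>Extending a cofinitary group by one generator\<close>

text \<open>The colour of a point stands for the block of the partition that contains it.\<close>

locale coloured_cardinal = regular_cardinal \<kappa> for \<kappa> :: "'a rel" +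
  fixes col :: "'a \<Rightarrow> 'c"
  assumes few_colours: "small (col ` K)"
    and pseudointersections: "\<And>F. F \<subseteq> Pow K \<Longrightarrow> strong_intersection_property \<kappa> F \<Longrightarrow>
      |F| <o |Pow K| \<Longrightarrow> \<exists>A. is_pseudointersection \<kappa> F A"
begin

definition good_group :: "('a \<Rightarrow> 'a) set \<Rightarrow> bool" where
  "good_group G \<longleftrightarrow> cofinitary_group \<kappa> G \<and> (\<forall>g\<in>G. \<forall>x\<in>K. col (g x) = col x)"

text \<open>These classes offer no fresh points. As there are few colours, their union is small, and
  the new generator can be prescribed on it.\<close>

definition small_classes :: "'a set" where
  "small_classes = {x \<in> K. small {y \<in> K. col y = col x}}"

interpretation Bij: group "BijGroup K" by (rule group_BijGroup)

lemma good_groupD: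
  assumes "good_group G"
  shows "subgroup G (BijGroup K)" "G \<subseteq> Bij K" "\<one>\<^bsub>BijGroup K\<^esub> \<in> G"
    "\<And>g. g \<in> G \<Longrightarrow> g \<noteq> \<one>\<^bsub>BijGroup K\<^esub> \<Longrightarrow> small {x \<in> K. g x = x}"
    "\<And>g x. g \<in> G \<Longrightarrow> x \<in> K \<Longrightarrow> col (g x) = col x"
proof -
  show 1: "subgroup G (BijGroup K)" using assms by (simp add: good_group_def cofinitary_group_def)
  show "G \<subseteq> Bij K" using subgroup.subset[OF 1] by simp
  show "\<one>\<^bsub>BijGroup K\<^esub> \<in> G" using subgroup.one_closed[OF 1] .
qed (use assms in \<open>auto simp: good_group_def cofinitary_group_def cofinitary_perm_def\<close>)

lemma small_small_classes: "small small_classes"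
proof -
  have "small_classes = (\<Union>c\<in>col ` small_classes. {y \<in> K. col y = c})"
    unfolding small_classes_def by auto
  moreover have "small (\<Union>c\<in>col ` small_classes. {y \<in> K. col y = c})"
  proof (rule small_UN)
    show "small (col ` small_classes)"
      by (rule small_subset[OF few_colours]) (auto simp: small_classes_def)
    show "small {y \<in> K. col y = c}" if "c \<in> col ` small_classes" for c
      using that by (auto simp: small_classes_def)
  qed
  ultimately show ?thesis by simp
qed

lemma col_preserving_generate:
  assumes "g \<in> generate (BijGroup K) X" "X \<subseteq> Bij K"
    and X: "\<And>f x. f \<in> X \<Longrightarrow> x \<in> K \<Longrightarrow> col (f x) = col x"
  shows "\<forall>x\<in>K. col (g x) = col x"
  using assms(1)
proof (induction rule: generate.induct)
  case one
  then show ?case by (simp add: BijGroup_one_app)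
next
  case (incl f)
  then show ?case using X by blast
next
  case (inv f)
  show ?case
  proof
    fix x assume x: "x \<in> K"
    have f: "f \<in> Bij K" using inv assms(2) by blast
    have "(inv\<^bsub>BijGroup K\<^esub> f) x \<in> K" using Bij_app[OF BijGroup_inv_closed[OF f] x] .
    from X[OF inv this] show "col ((inv\<^bsub>BijGroup K\<^esub> f) x) = col x"
      using BijGroup_inv_app(2)[OF f x] by simp
  qed
next
  case (eng g1 g2)
  have "X \<subseteq> carrier (BijGroup K)" using assms(2) by simp
  then have "g1 \<in> Bij K" "g2 \<in> Bij K"
    using Bij.generate_in_carrier eng.hyps by (metis BijGroup_carrier)+
  then show ?case using eng.IH Bij_app[of g2 K] by (simp add: BijGroup_mult_app)
qed

text \<open>A class that meets \<open>K - S\<close> is not small, and removing the small set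
  \<open>S\<close> does not change that.\<close>

lemma sparse_extension_diff:
  assumes d: "\<And>x. x \<in> K \<Longrightarrow> x \<preceq> d x" and S: "small S" "small_classes \<subseteq> S"
  shows "sparse_extension \<kappa> d (K - S) col"
proof
  fix x assume x: "x \<in> K - S"
  then have "\<not> small {y \<in> K. col y = col x}" using S(2) by (auto simp: small_classes_def)
  then have "\<not> small ({y \<in> K. col y = col x} - S)" using not_small_diff S(1) by blast
  moreover have "{y \<in> K. col y = col x} - S = {y \<in> K - S. col y = col x}" by blast
  ultimately show "\<not> small {y \<in> K - S. col y = col x}" by simp
qed (use d in auto)

text \<open>Two demands are left open here: the values \<open>s\<close> on a small set, and edge
  sets \<open>R\<close> that enter the graph arbitrarily high. One application uses only the first,
  the spoiling argument uses both.\<close>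

lemma exists_generic:
  assumes G: "good_group G"
    and d: "\<And>x. x \<in> K \<Longrightarrow> x \<preceq> d x" "\<And>a. a \<in> G \<Longrightarrow> small {x \<in> K. \<not> a x \<preceq> d x}"
    and S: "small S" "small_classes \<subseteq> S" "S \<subseteq> K"
    and s: "bij_betw s S S" "\<And>x. x \<in> S \<Longrightarrow> col (s x) = col x"
    and R: "\<And>r. r \<in> R \<Longrightarrow> small r \<and> sparse_extension.sparse \<kappa> d (K - S) col R r"
      "\<And>b. b \<in> K \<Longrightarrow> \<exists>r\<in>R. \<forall>e\<in>r. b \<prec> fst e \<and> b \<prec> snd e"
      "\<And>a. a \<in> G \<Longrightarrow> a \<noteq> \<one>\<^bsub>BijGroup K\<^esub> \<Longrightarrow>
        small {t \<in> K. a t \<noteq> t \<and> (\<exists>r\<in>R. \<exists>e\<in>r. \<exists>e'\<in>r. t = hi e \<and> a t = hi e')}"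
  obtains g where "g \<in> Bij K" "good_group (generate (BijGroup K) (insert g G))"
    "\<And>x. x \<in> S \<Longrightarrow> g x = s x"
    "\<And>b. b \<in> K \<Longrightarrow> \<exists>r\<in>R. (\<forall>e\<in>r. b \<prec> fst e \<and> b \<prec> snd e) \<and> (\<forall>e\<in>r. snd e = g (fst e))"
proof -
  interpret E: sparse_extension \<kappa> d "K - S" col R
    by (rule sparse_extension_diff[OF d(1) S(1,2)])
  have KS: "K - (K - S) = S" using S(3) by blast
  have Rb: "\<exists>r\<in>R. E.beyond b r" if "b \<in> K" for b using R(2)[OF that] by (simp add: E.beyond_def)
  obtain g where g: "g \<in> Bij K" "\<And>x. x \<in> K \<Longrightarrow> col (g x) = col x"
    "\<And>x. x \<in> K - (K - S) \<Longrightarrow> g x = s x" "E.sparse ((\<lambda>x. (x, g x)) ` (K - S))"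
    "\<And>b. b \<in> K \<Longrightarrow> \<exists>r\<in>R. E.beyond b r \<and> r \<subseteq> (\<lambda>x. (x, g x)) ` (K - S)"
    by (rule E.exists_sparse_permutation[of s]) (use R(1) Rb s KS in auto)
  let ?H = "generate (BijGroup K) (insert g G)"
  have sub: "insert g G \<subseteq> Bij K" using g(1) good_groupD(2)[OF G] by blast
  have "small {x \<in> K. u x = x}" if "u \<in> ?H" "u \<noteq> \<one>\<^bsub>BijGroup K\<^esub>" for u
    by (rule E.small_fixpoints_generate[OF good_groupD(1)[OF G] g(1) _ g(4) d(2)
          good_groupD(4)[OF G] R(3) that]) (simp_all add: KS S(1))
  moreover have "subgroup ?H (BijGroup K)" using Bij.generate_is_subgroup sub by simp
  moreover have "\<forall>x\<in>K. col (f x) = col x" if "f \<in> insert g G" for f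
    using that g(2) good_groupD(5)[OF G] by blast
  then have "\<forall>x\<in>K. col (u x) = col x" if "u \<in> ?H" for u
    using col_preserving_generate[OF that sub] by blast
  ultimately have "good_group ?H"
    by (simp add: good_group_def cofinitary_group_def cofinitary_perm_def)
  moreover have "g x = s x" if "x \<in> S" for x using g(3) KS that by blast
  moreover have "\<exists>r\<in>R. (\<forall>e\<in>r. b \<prec> fst e \<and> b \<prec> snd e) \<and> (\<forall>e\<in>r. snd e = g (fst e))"
    if b: "b \<in> K" for b
  proof -
    obtain r where r: "r \<in> R" "E.beyond b r" "r \<subseteq> (\<lambda>x. (x, g x)) ` (K - S)"
      using g(5)[OF b] by blast
    have "\<forall>e\<in>r. snd e = g (fst e)" using r(3) by auto
    then show ?thesis using r(1,2) unfolding E.beyond_def by blast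
  qed
  ultimately show thesis using that[of g] g(1) by blast
qed

lemma good_group_dominating:
  assumes "good_group G" "|G| <o |Pow K|"
  shows "\<exists>d. (\<forall>x\<in>K. x \<preceq> d x) \<and> (\<forall>a\<in>G. small {x \<in> K. \<not> a x \<preceq> d x})"
proof (rule dominating_function[of G])
  show "\<exists>A. is_pseudointersection \<kappa> F A"
    if "F \<subseteq> Pow K" "strong_intersection_property \<kappa> F" "|F| <o |Pow K|" for F
    using pseudointersections that .
  show "f x \<in> K" if "f \<in> G" "x \<in> K" for f x
    using that good_groupD(2)[OF assms(1)] Bij_app[of f K x] by auto
qed (use assms(2) in blast)+

text \<open>The support of \<open>h\<close> together with the small classes is a small set invariant
  under \<open>h\<close>, so \<open>h\<close> itself can be prescribed on it.\<close>

lemma exists_extending_small_support: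
  assumes G: "good_group G" "|G| <o |Pow K|" and h: "h \<in> Bij K" "small {x \<in> K. h x \<noteq> x}"
    "\<And>x. x \<in> K \<Longrightarrow> col (h x) = col x"
  shows "\<exists>g\<in>Bij K. good_group (generate (BijGroup K) (insert g G)) \<and>
           (\<forall>x\<in>K. h x \<noteq> x \<longrightarrow> g x = h x)"
proof -
  obtain d where d: "\<And>x. x \<in> K \<Longrightarrow> x \<preceq> d x" "\<And>a. a \<in> G \<Longrightarrow> small {x \<in> K. \<not> a x \<preceq> d x}"
    using good_group_dominating[OF G] by blast
  define S where "S = small_classes \<union> {x \<in> K. h x \<noteq> x}"
  have hb: "bij_betw h K K" using h(1) by (simp add: Bij_def)
  have SK: "S \<subseteq> K" by (auto simp: S_def small_classes_def)
  have hS: "h x \<in> S \<longleftrightarrow> x \<in> S" if "x \<in> K" for x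
  proof -
    have "h (h x) = h x \<longleftrightarrow> h x = x"
      using that hb Bij_app[OF h(1)] by (auto simp: bij_betw_def inj_on_def)
    moreover have "h x \<in> small_classes \<longleftrightarrow> x \<in> small_classes"
      using that h(3)[OF that] Bij_app[OF h(1) that] by (simp add: small_classes_def)
    ultimately show ?thesis using that Bij_app[OF h(1) that] by (simp add: S_def)
  qed
  have "h ` S = S"
  proof
    show "h ` S \<subseteq> S" using hS SK by blast
    show "S \<subseteq> h ` S"
    proof
      fix y assume y: "y \<in> S"
      then obtain x where "x \<in> K" "y = h x" using hb SK by (auto simp: bij_betw_def)
      then show "y \<in> h ` S" using hS y by blast
    qed
  qed
  then have bij: "bij_betw h S S" using hb SK by (auto simp: bij_betw_def inj_on_subset)
  have small: "small S" unfolding S_def by (intro small_Un small_small_classes h(2))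
  obtain b0 where "b0 \<in> K" using infinite infinite_imp_nonempty by blast
  have sS: "small_classes \<subseteq> S" by (simp add: S_def)
  interpret E: sparse_extension \<kappa> d "K - S" col "{{}}"
    by (rule sparse_extension_diff[OF d(1) small sS])
  obtain g where "g \<in> Bij K" "good_group (generate (BijGroup K) (insert g G))"
    "\<And>x. x \<in> S \<Longrightarrow> g x = h x"
  proof (rule exists_generic[OF G(1) d small sS SK bij, of "{{}}"])
    show "col (h x) = col x" if "x \<in> S" for x using that SK h(3) by blast
  qed (auto simp: small_finite E.sparse_def)
  then show ?thesis unfolding S_def by blast
qed

lemma not_small_exceeds:
  assumes "\<not> small Y" "Y \<subseteq> K" "h \<in> Bij K" "b \<in> K"
  obtains z where "z \<in> Y" "b \<prec> z" "b \<prec> h z"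
proof -
  let ?X = "{z. z \<preceq> b} \<union> {z \<in> K. h z \<in> {y. y \<preceq> b}}"
  have "small ?X"
    by (intro small_Un small_below_le[OF assms(4)] small_Bij_preimage[OF assms(3)])
  then have "\<not> Y \<subseteq> ?X" using assms(1) small_subset by blast
  then obtain z where z: "z \<in> Y" "z \<notin> ?X" by blast
  then have "z \<in> K" "\<not> z \<preceq> b" "\<not> h z \<preceq> b" using assms(2) by auto
  then show thesis using that[OF z(1)] not_le assms(4) Bij_app[OF assms(3), of z] by simp
qed

text \<open>Some pair of colours \<open>c\<close>, \<open>c'\<close> is such that \<open>h\<close> maps \<open>\<kappa>\<close> many points \<open>z\<close> of colour \<open>c\<close> to points
  of colour \<open>c'\<close>. A generic \<open>g\<close> mapping \<open>z1\<close> to \<open>z2\<close> and \<open>h z2\<close> to \<open>h z1\<close> for \<open>\<kappa>\<close> many pairs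
  of such points makes \<open>z1\<close> a fixed point of \<open>h\<inverse> g h g\<close>. It respects the colours even if \<open>h\<close>
  does not.\<close>

lemma exists_spoiling:
  assumes G: "good_group G" "|G| <o |Pow K|" and h: "h \<in> Bij K"
    and hG: "\<And>a. a \<in> G \<Longrightarrow> small {z \<in> K. h z = a z}"
  shows "\<exists>g\<in>Bij K. good_group (generate (BijGroup K) (insert g G)) \<and>
    \<not> small {x \<in> K. g (h (g x)) = h x} \<and>
    (\<exists>x\<in>K. g (h (g x)) \<noteq> h x)"
proof -
  obtain d where d: "\<And>x. x \<in> K \<Longrightarrow> x \<preceq> d x" "\<And>a. a \<in> G \<Longrightarrow> small {x \<in> K. \<not> a x \<preceq> d x}"
    using good_group_dominating[OF G] by blast
  have dK: "d x \<in> K" if "x \<in> K" for x using d(1)[OF that] le_in_K by blast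
  note hK = Bij_app[OF h]
  have h_inj: "x = y" if "h x = h y" "x \<in> K" "y \<in> K" for x y
    using that h by (auto simp: Bij_def bij_betw_def inj_on_def)
  have hid: "small {z \<in> K. h z = z}"
  proof -
    have "{z \<in> K. h z = z} \<subseteq> {z \<in> K. h z = \<one>\<^bsub>BijGroup K\<^esub> z}" by (auto simp: BijGroup_one_app)
    then show ?thesis using hG[OF good_groupD(3)[OF G(1)]] small_subset by blast
  qed
  define Z where "Z c c' = {z \<in> K. col z = c \<and> col (h z) = c'}" for c c'
  \<comment> \<open>There are fewer than \<kappa> pairs of colours, and the sets
    \<open>Z c c'\<close> cover \<open>K\<close>.\<close>
  have "\<exists>c c'. \<not> small (Z c c')"
  proof (rule ccontr)
    assume "\<nexists>c c'. \<not> small (Z c c')"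
    then have "small (\<Union>(c, c')\<in>col ` K \<times> col ` K. Z c c')"
      by (intro small_UN small_times few_colours) auto
    moreover have "K \<subseteq> (\<Union>(c, c')\<in>col ` K \<times> col ` K. Z c c')" using hK by (auto simp: Z_def)
    ultimately show False using not_small_K small_subset by blast
  qed
  then obtain c c' where cc': "\<not> small (Z c c')" by blast
  define C where "C = {y \<in> K. col y = c}"
  have "Z c c' \<subseteq> C" by (auto simp: Z_def C_def)
  then have C: "\<not> small C" "C \<subseteq> K" using cc' small_subset[of C "Z c c'"] by (auto simp: C_def)
  \<comment> \<open>As \<open>h\<close> has few fixed points, some point \<open>x\<close> of
    \<open>C\<close> is the image of a different point \<open>z0\<close>.\<close>
  have "\<not> C \<subseteq> h ` {z \<in> K. h z = z}" using C(1) small_subset[OF small_image[OF hid]] by metis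
  then obtain x where x: "x \<in> C" "x \<notin> h ` {z \<in> K. h z = z}" by blast
  then have "x \<in> h ` K" using C(2) h by (auto simp: Bij_def bij_betw_def)
  then obtain z0 where z0: "z0 \<in> K" "h z0 = x" by blast
  have "z0 \<noteq> x"
  proof
    assume "z0 = x"
    then have "z0 \<in> {z \<in> K. h z = z}" using z0 by simp
    then show False using x(2) z0(2) by blast
  qed
  note z0 = z0 this
  have "\<not> C \<subseteq> {x, z0}" using C(1) small_subset[OF small_finite[of "{x, z0}"]] by auto
  then obtain y where y: "y \<in> C" "y \<noteq> x" "y \<noteq> z0" by blast
  have xy: "x \<in> K" "y \<in> K" "col x = col y" using x y by (auto simp: C_def)
  define S where "S = small_classes \<union> {x, y, z0}"
  \<comment> \<open>\<open>s\<close> exchanges \<open>x\<close> and \<open>y\<close> and fixes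
    \<open>z0\<close>, so that \<open>g (h (g z0)) = g x = y\<close> differs from
    \<open>h z0 = x\<close>. This keeps the word that spoils \<open>h\<close> from being the
    identity.\<close>
  define s where "s t = (if t = x then y else if t = y then x else t)" for t
  have S: "small S" "small_classes \<subseteq> S" "S \<subseteq> K"
    using small_Un[OF small_small_classes small_finite[of "{x, y, z0}"]] xy z0(1)
    by (auto simp: S_def small_classes_def)
  have s: "bij_betw s S S" by (rule bij_betw_byWitness[of S s s]) (auto simp: s_def S_def)
  have scol: "col (s t) = col t" for t using xy(3) by (simp add: s_def)
  \<comment> \<open>The removal keeps all ends of the pairs outside \<open>S\<close> and, by
    \<open>h z \<noteq> z\<close>, the two upper ends of a pair distinct.\<close>
  define Z' where "Z' = Z c c' - (S \<union> ({z \<in> K. h z \<in> S} \<union> {z \<in> K. h z = z}))"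
  have Z': "\<not> small Z'" "Z' \<subseteq> K"
    unfolding Z'_def
    using not_small_diff[OF cc' small_Un[OF S(1) small_Un[OF small_Bij_preimage[OF h S(1)] hid]]]
    by (simp, auto simp: Z_def)
  have Z'D: "z \<in> K - S" "h z \<in> K - S" "col z = c" "col (h z) = c'" "h z \<noteq> z" if "z \<in> Z'" for z
    using that hK by (auto simp: Z'_def Z_def)
  define pair where "pair z1 z2 = {(z1, z2), (h z2, h z1)}" for z1 z2
  \<comment> \<open>The inequalities with \<open>d\<close> make \<open>z2\<close> and
    \<open>h z2\<close> the upper ends. The last two keep the sources of the two edges apart, and
    likewise their targets.\<close>
  define R where "R = {pair z1 z2 |z1 z2. z1 \<in> Z' \<and> z2 \<in> Z' \<and> d z1 \<prec> z2 \<and> d (h z1) \<prec> h z2 \<and>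
    z1 \<prec> h z2 \<and> h z1 \<prec> z2}"
  have RE: thesis if r: "r \<in> R" and th:
    "\<And>z1 z2. r = pair z1 z2 \<Longrightarrow> z1 \<in> Z' \<Longrightarrow> z2 \<in> Z' \<Longrightarrow> d z1 \<prec> z2 \<Longrightarrow> d (h z1) \<prec> h z2 \<Longrightarrow>
      z1 \<prec> h z2 \<Longrightarrow> h z1 \<prec> z2 \<Longrightarrow> hi (z1, z2) = z2 \<Longrightarrow> lo (z1, z2) = z1 \<Longrightarrow>
      hi (h z2, h z1) = h z2 \<Longrightarrow> lo (h z2, h z1) = h z1 \<Longrightarrow> thesis" for r thesis
  proof -
    obtain z1 z2 where z: "r = pair z1 z2" "z1 \<in> Z'" "z2 \<in> Z'" "d z1 \<prec> z2" "d (h z1) \<prec> h z2"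
      "z1 \<prec> h z2" "h z1 \<prec> z2" using r unfolding R_def by blast
    have "z1 \<prec> z2" "h z1 \<prec> h z2" using z d(1) Z'D le_lt_trans by blast+
    then show thesis using th[OF z] hi_lo_upward by blast
  qed
  interpret E: sparse_extension \<kappa> d "K - S" col R
    by (rule sparse_extension_diff[OF d(1) S(1,2)])
  have sparse: "small r \<and> E.sparse r" if r: "r \<in> R" for r
  proof (rule RE[OF r])
    fix z1 z2
    assume z: "r = pair z1 z2" "z1 \<in> Z'" "z2 \<in> Z'" "d z1 \<prec> z2" "d (h z1) \<prec> h z2"
      "z1 \<prec> h z2" "h z1 \<prec> z2" and hl: "hi (z1, z2) = z2" "lo (z1, z2) = z1"
      "hi (h z2, h z1) = h z2" "lo (h z2, h z1) = h z1"
    have "E.good_edge (z1, z2)" "E.good_edge (h z2, h z1)"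
      unfolding E.good_edge_def hl using z Z'D by simp_all
    moreover have "E.compatible (z1, z2) (h z2, h z1)"
    proof -
      have "z1 \<noteq> h z2" "z2 \<noteq> h z1" using z(6,7) lt_irrefl by blast+
      moreover have "(z1, z2) \<in> r" "(h z2, h z1) \<in> r" by (simp_all add: z(1) pair_def)
      ultimately show ?thesis unfolding E.compatible_def hl using Z'D(5)[OF z(3)] r by auto
    qed
    ultimately show "small r \<and> E.sparse r"
      using E.compatible_sym by (auto simp: z(1) pair_def E.sparse_def small_finite)
  qed
  have beyond: "\<exists>r\<in>R. \<forall>e\<in>r. b \<prec> fst e \<and> b \<prec> snd e" if b: "b \<in> K" for b
  proof -
    obtain z1 where z1: "z1 \<in> Z'" "b \<prec> z1" "b \<prec> h z1"
      using not_small_exceeds[OF Z' h b] by blast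
    have z1K: "z1 \<in> K" "h z1 \<in> K" using Z'D z1(1) by auto
    obtain b' where b': "b' \<in> K" "\<And>t. t \<in> {z1, h z1, d z1, d (h z1)} \<Longrightarrow> t \<prec> b'"
      using small_bounded[OF small_finite[of "{z1, h z1, d z1, d (h z1)}"]] z1K dK by auto
    obtain z2 where z2: "z2 \<in> Z'" "b' \<prec> z2" "b' \<prec> h z2"
      using not_small_exceeds[OF Z' h b'(1)] by blast
    have lt: "t \<prec> z2 \<and> t \<prec> h z2" if "t \<in> {z1, h z1, d z1, d (h z1)}" for t
      using b'(2)[OF that] z2(2,3) lt_trans by blast
    then have "pair z1 z2 \<in> R" unfolding R_def using z1(1) z2(1) by blast
    moreover have "\<forall>e\<in>pair z1 z2. b \<prec> fst e \<and> b \<prec> snd e"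
      using z1(2,3) lt[of z1] lt_trans by (auto simp: pair_def)
    ultimately show ?thesis by blast
  qed
  \<comment> \<open>The upper ends of a pair are \<open>z2\<close> and \<open>h z2\<close>. If
    \<open>a\<close> links them, then \<open>a\<close> or its inverse agrees with \<open>h\<close>
    at \<open>z2\<close>, which \<open>hG\<close> makes rare.\<close>
  have spread: "small {t \<in> K. a t \<noteq> t \<and> (\<exists>r\<in>R. \<exists>e\<in>r. \<exists>e'\<in>r. t = hi e \<and> a t = hi e')}"
    if a: "a \<in> G" for a
  proof -
    let ?i = "inv\<^bsub>BijGroup K\<^esub> a"
    have aB: "a \<in> Bij K" using a good_groupD(2)[OF G(1)] by blast
    have i: "?i \<in> G" using a subgroup.m_inv_closed[OF good_groupD(1)[OF G(1)]] by blast
    have "{t \<in> K. a t \<noteq> t \<and> (\<exists>r\<in>R. \<exists>e\<in>r. \<exists>e'\<in>r. t = hi e \<and> a t = hi e')} \<subseteq>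
        {z \<in> K. h z = a z} \<union> h ` {z \<in> K. h z = ?i z}"
    proof
      fix t assume "t \<in> {t \<in> K. a t \<noteq> t \<and> (\<exists>r\<in>R. \<exists>e\<in>r. \<exists>e'\<in>r. t = hi e \<and> a t = hi e')}"
      then obtain r e e' where t: "t \<in> K" "a t \<noteq> t" "r \<in> R" "e \<in> r" "e' \<in> r" "t = hi e" "a t = hi e'"
        by blast
      show "t \<in> {z \<in> K. h z = a z} \<union> h ` {z \<in> K. h z = ?i z}"
      proof (rule RE[OF t(3)])
        fix z1 z2
        assume z: "r = pair z1 z2" "z2 \<in> Z'" and hl: "hi (z1, z2) = z2" "hi (h z2, h z1) = h z2"
        have "t = z2 \<and> a t = h z2 \<or> t = h z2 \<and> a t = z2"
          using t(2,4-7) hl unfolding z(1) pair_def by auto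
        then show ?thesis
        proof
          assume "t = h z2 \<and> a t = z2"
          then have az: "t = h z2" "a t = z2" by blast+
          have "?i z2 = h z2" using BijGroup_inv_app(1)[OF aB t(1)] unfolding az(2) by (simp add: az(1))
          then have "z2 \<in> {z \<in> K. h z = ?i z}" using Z'D(1)[OF z(2)] by simp
          then show ?thesis using az(1) by blast
        qed (use t(1) in auto)
      qed
    qed
    moreover have "small ({z \<in> K. h z = a z} \<union> h ` {z \<in> K. h z = ?i z})"
      by (intro small_Un small_image hG a i)
    ultimately show ?thesis using small_subset by blast
  qed
  obtain g where g: "g \<in> Bij K" "good_group (generate (BijGroup K) (insert g G))"
    "\<And>x. x \<in> S \<Longrightarrow> g x = s x"
    "\<And>b. b \<in> K \<Longrightarrow> \<exists>r\<in>R. (\<forall>e\<in>r. b \<prec> fst e \<and> b \<prec> snd e) \<and> (\<forall>e\<in>r. snd e = g (fst e))"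
    using exists_generic[OF G(1) d S s scol sparse beyond spread] by blast
  have "\<not> small {x \<in> K. g (h (g x)) = h x}"
  proof (rule unbounded_not_small)
    fix b assume "b \<in> K"
    then obtain r where r: "r \<in> R" "\<forall>e\<in>r. b \<prec> fst e" "\<forall>e\<in>r. snd e = g (fst e)"
      using g(4) by metis
    show "\<exists>x\<in>{x \<in> K. g (h (g x)) = h x}. b \<preceq> x"
    proof (rule RE[OF r(1)])
      fix z1 z2 assume "r = pair z1 z2" "z1 \<in> Z'"
      then have "g (h (g z1)) = h z1" "b \<preceq> z1" "z1 \<in> K"
        using r(2,3) lt_le Z'D by (auto simp: pair_def)
      then show ?thesis by blast
    qed
  qed
  moreover have "g (h (g z0)) \<noteq> h z0"
    using g(3) z0 y by (auto simp: S_def s_def)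
  ultimately show ?thesis using g(1,2) z0(1) by auto
qed

section \<open>The recursion\<close>

text \<open>A permutation is coded by its graph, a subset of \<open>K \<times> K\<close>.\<close>

lemma card_of_Bij: "|Bij K| \<le>o |Pow K|"
proof -
  obtain p where p: "bij_betw p (K \<times> K) K"
    using card_of_Times_same_infinite[OF infinite] card_of_ordIso by blast
  define F where "F f = p ` ((\<lambda>x. (x, f x)) ` K)" for f :: "'a \<Rightarrow> 'a"
  have sub: "(\<lambda>x. (x, f x)) ` K \<subseteq> K \<times> K" if "f \<in> Bij K" for f using Bij_app[OF that] by auto
  have "inj_on F (Bij K)"
  proof (rule inj_onI)
    fix f f' assume f: "f \<in> Bij K" "f' \<in> Bij K" "F f = F f'"
    have "(\<lambda>x. (x, f x)) ` K = (\<lambda>x. (x, f' x)) ` K"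
      using inj_on_image_eq_iff[OF bij_betw_imp_inj_on[OF p] sub[OF f(1)] sub[OF f(2)]] f(3)
      unfolding F_def by blast
    then have "f x = f' x" if "x \<in> K" for x using that by auto
    then show "f = f'" by (rule Bij_eqI[OF f(1,2)])
  qed
  moreover have "F ` Bij K \<subseteq> Pow K"
  proof (rule image_subsetI)
    fix f assume "f \<in> Bij K"
    from image_mono[OF sub[OF this], of p] show "F f \<in> Pow K"
      using p by (simp add: F_def bij_betw_def)
  qed
  ultimately show ?thesis using card_of_ordLeq[of "Bij K" "Pow K"] by blast
qed

text \<open>The second part, for transpositions \<open>h\<close>, is what makes the final group transitive on each colour.\<close>

definition settles :: "('a \<Rightarrow> 'a) set \<Rightarrow> ('a \<Rightarrow> 'a) \<Rightarrow> bool" where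
  "settles V h \<longleftrightarrow> (\<forall>H. cofinitary_group \<kappa> H \<longrightarrow> insert h V \<subseteq> H \<longrightarrow> h \<in> V) \<and>
     (small {x \<in> K. h x \<noteq> x} \<longrightarrow> (\<forall>x\<in>K. col (h x) = col x) \<longrightarrow>
       (\<exists>g\<in>V. \<forall>x\<in>K. h x \<noteq> x \<longrightarrow> g x = h x))"

lemma cofinitary_groupD:
  assumes "cofinitary_group \<kappa> H" "u \<in> H" "\<not> small {x \<in> K. u x = x}"
  shows "u = \<one>\<^bsub>BijGroup K\<^esub>"
  using assms by (auto simp: cofinitary_group_def cofinitary_perm_def)

text \<open>If \<open>h\<close> agrees only rarely with each element of \<open>G\<close>, a spoiling
  \<open>g\<close> excludes \<open>h\<close> from every cofinitary group above. Otherwise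
  \<open>h\<close> agrees with some \<open>a\<close> in \<open>G\<close> at \<kappa> many points,
  and a cofinitary group containing both has \<open>h = a\<close>; the new generator then serves the
  second half of \<open>settles\<close>.\<close>

lemma exists_settling:
  assumes G: "good_group G" "|G| <o |Pow K|" and h: "h \<in> Bij K"
  shows "\<exists>g\<in>Bij K. good_group (generate (BijGroup K) (insert g G)) \<and>
           settles (generate (BijGroup K) (insert g G)) h"
proof (cases "\<forall>a\<in>G. small {z \<in> K. h z = a z}")
  case True
  then obtain g where g: "g \<in> Bij K" "good_group (generate (BijGroup K) (insert g G))"
      "\<not> small {x \<in> K. g (h (g x)) = h x}" "\<exists>x\<in>K. g (h (g x)) \<noteq> h x"
    using exists_spoiling[OF G h] by blast
  let ?V = "generate (BijGroup K) (insert g G)"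
  let ?u = "inv\<^bsub>BijGroup K\<^esub> h \<otimes>\<^bsub>BijGroup K\<^esub> (g \<otimes>\<^bsub>BijGroup K\<^esub> (h \<otimes>\<^bsub>BijGroup K\<^esub> g))"
  have "settles ?V h"
    unfolding settles_def
  proof (intro conjI allI impI)
    fix H assume H: "cofinitary_group \<kappa> H" "insert h ?V \<subseteq> H"
    have sub: "subgroup H (BijGroup K)" using H(1) by (simp add: cofinitary_group_def)
    have "g \<in> H" "h \<in> H" using H(2) generate.incl[of g "insert g G" "BijGroup K"] by auto
    then have u: "?u \<in> H" using sub by (intro subgroup.m_closed subgroup.m_inv_closed)
    have hg: "h \<otimes>\<^bsub>BijGroup K\<^esub> g \<in> Bij K" "g \<otimes>\<^bsub>BijGroup K\<^esub> (h \<otimes>\<^bsub>BijGroup K\<^esub> g) \<in> Bij K"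
      using Bij.m_closed[of h g] Bij.m_closed[of g "h \<otimes>\<^bsub>BijGroup K\<^esub> g"] g(1) h by simp_all
    have app: "?u x = (inv\<^bsub>BijGroup K\<^esub> h) (g (h (g x)))" if "x \<in> K" for x
      using BijGroup_mult_app[OF BijGroup_inv_closed[OF h] hg(2) that]
        BijGroup_mult_app[OF g(1) hg(1) that] BijGroup_mult_app[OF h g(1) that] by simp
    have fix_iff: "?u x = x \<longleftrightarrow> g (h (g x)) = h x" if x: "x \<in> K" for x
    proof -
      have "g (h (g x)) \<in> K" by (intro Bij_app[OF g(1)] Bij_app[OF h] x)
      then show ?thesis unfolding app[OF x]
        using BijGroup_inv_app(1)[OF h x] BijGroup_inv_app(2)[OF h, of "g (h (g x))"] by metis
    qed
    have "{x \<in> K. ?u x = x} = {x \<in> K. g (h (g x)) = h x}" using fix_iff by blast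
    then have "?u = \<one>\<^bsub>BijGroup K\<^esub>" using cofinitary_groupD[OF H(1) u] g(3) by simp
    then have "?u x = x" if "x \<in> K" for x using BijGroup_one_app[OF that] by simp
    then show "h \<in> ?V" using fix_iff g(4) by blast
  next
    \<comment> \<open>A permutation of small support agrees with the identity at \<kappa> many
      points, against the assumption of this case.\<close>
    assume "small {x \<in> K. h x \<noteq> x}"
    moreover have "small {z \<in> K. h z = \<one>\<^bsub>BijGroup K\<^esub> z}" using True good_groupD(3)[OF G(1)] by blast
    ultimately have "small ({x \<in> K. h x \<noteq> x} \<union> {z \<in> K. h z = \<one>\<^bsub>BijGroup K\<^esub> z})" by (rule small_Un)
    moreover have "{x \<in> K. h x \<noteq> x} \<union> {z \<in> K. h z = \<one>\<^bsub>BijGroup K\<^esub> z} = K"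
      by (auto simp: BijGroup_one_app)
    ultimately show "\<exists>g\<in>?V. \<forall>x\<in>K. h x \<noteq> x \<longrightarrow> g x = h x" using not_small_K by simp
  qed
  then show ?thesis using g(1,2) by blast
next
  case False
  then obtain a where a: "a \<in> G" "\<not> small {z \<in> K. h z = a z}" by blast
  have aB: "a \<in> Bij K" using a(1) good_groupD(2)[OF G(1)] by blast
  have one: "\<one>\<^bsub>BijGroup K\<^esub> \<in> Bij K" using Bij.one_closed by simp
  have aH: "h = a" if H: "cofinitary_group \<kappa> H" "h \<in> H" "a \<in> H" for H
  proof -
    let ?u = "inv\<^bsub>BijGroup K\<^esub> a \<otimes>\<^bsub>BijGroup K\<^esub> h"
    have sub: "subgroup H (BijGroup K)" using H(1) by (simp add: cofinitary_group_def)
    have u: "?u \<in> H" using sub H(2,3) by (intro subgroup.m_closed subgroup.m_inv_closed)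
    have "{z \<in> K. h z = a z} \<subseteq> {z \<in> K. ?u z = z}"
      using BijGroup_mult_app[OF BijGroup_inv_closed[OF aB] h] BijGroup_inv_app(1)[OF aB] by auto
    then have "\<not> small {z \<in> K. ?u z = z}" using a(2) small_subset by blast
    then have "?u = \<one>\<^bsub>BijGroup K\<^esub>" using cofinitary_groupD[OF H(1) u] by blast
    then show ?thesis
      using Bij.inv_solve_left'[of "\<one>\<^bsub>BijGroup K\<^esub>" a h] h aB one by simp
  qed
  \<comment> \<open>The identity is a harmless substitute when the second half of
    \<open>settles\<close> demands nothing of \<open>h\<close>.\<close>
  define h' where "h' = (if small {x \<in> K. h x \<noteq> x} \<and> (\<forall>x\<in>K. col (h x) = col x) then h
    else \<one>\<^bsub>BijGroup K\<^esub>)"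
  have "{x \<in> K. \<one>\<^bsub>BijGroup K\<^esub> x \<noteq> x} = {}" by (auto simp: BijGroup_one_app)
  then have "small {x \<in> K. \<one>\<^bsub>BijGroup K\<^esub> x \<noteq> x}" by (simp only: small_finite finite.emptyI)
  then have h': "h' \<in> Bij K" "small {x \<in> K. h' x \<noteq> x}" "\<And>x. x \<in> K \<Longrightarrow> col (h' x) = col x"
    using h one by (auto simp: h'_def BijGroup_one_app)
  obtain g where g: "g \<in> Bij K" "good_group (generate (BijGroup K) (insert g G))"
      "\<And>x. x \<in> K \<Longrightarrow> h' x \<noteq> x \<Longrightarrow> g x = h' x"
    using exists_extending_small_support[OF G h'] by blast
  let ?V = "generate (BijGroup K) (insert g G)"
  have V: "insert g G \<subseteq> ?V" by (auto intro: generate.incl)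
  have "settles ?V h"
    unfolding settles_def
  proof (intro conjI allI impI)
    fix H assume H: "cofinitary_group \<kappa> H" "insert h ?V \<subseteq> H"
    then have "h = a" using aH[of H] V a(1) by blast
    then show "h \<in> ?V" using V a(1) by blast
  next
    assume "small {x \<in> K. h x \<noteq> x}" "\<forall>x\<in>K. col (h x) = col x"
    then have "h' = h" by (simp add: h'_def)
    then show "\<exists>g\<in>?V. \<forall>x\<in>K. h x \<noteq> x \<longrightarrow> g x = h x" using g(3) V by blast
  qed
  then show ?thesis using g(1,2) by blast
qed

lemma good_group_chain_Union:
  assumes "C \<noteq> {}" "\<And>G. G \<in> C \<Longrightarrow> good_group G" "\<And>G H. G \<in> C \<Longrightarrow> H \<in> C \<Longrightarrow> G \<subseteq> H \<or> H \<subseteq> G"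
  shows "good_group (\<Union>C)"
proof -
  note D = good_groupD[OF assms(2)]
  have "subgroup (\<Union>C) (BijGroup K)"
  proof (rule subgroup.intro)
    show "\<Union>C \<subseteq> carrier (BijGroup K)" using D(2) by auto
    show "\<one>\<^bsub>BijGroup K\<^esub> \<in> \<Union>C" using D(3) assms(1) by blast
    show "inv\<^bsub>BijGroup K\<^esub> x \<in> \<Union>C" if x: "x \<in> \<Union>C" for x
      using x subgroup.m_inv_closed[OF D(1)] by blast
    show "x \<otimes>\<^bsub>BijGroup K\<^esub> y \<in> \<Union>C" if "x \<in> \<Union>C" "y \<in> \<Union>C" for x y
    proof -
      obtain G where "G \<in> C" "x \<in> G" "y \<in> G" using \<open>x \<in> \<Union>C\<close> \<open>y \<in> \<Union>C\<close> assms(3) by blast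
      then show ?thesis using subgroup.m_closed[OF D(1)] by blast
    qed
  qed
  then show ?thesis using D(4,5) by (auto simp: good_group_def cofinitary_group_def cofinitary_perm_def)
qed

lemma good_group_trivial: "good_group {\<one>\<^bsub>BijGroup K\<^esub>}"
  using Bij.triv_subgroup by (auto simp: good_group_def cofinitary_group_def BijGroup_one_app)

lemma transposition_Bij:
  assumes "x \<in> K" "y \<in> K"
  shows "(\<lambda>t\<in>K. if t = x then y else if t = y then x else t) \<in> Bij K"
proof -
  let ?h = "\<lambda>t\<in>K. if t = x then y else if t = y then x else t"
  have "bij_betw ?h K K" by (rule bij_betw_byWitness[of K ?h ?h]) (use assms in auto)
  then show ?thesis by (simp add: Bij_def)
qed

text \<open>The recursion follows a well-order of all permutations whose proper initial segments
  have size below \<open>2^\<kappa>\<close>. The groups constructed at its stages therefore stay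
  small enough to be dominated, and stage \<open>h\<close> settles \<open>h\<close>.\<close>

lemma exists_maximal_transitive:
  obtains G where "maximal_cofinitary_group \<kappa> G" "good_group G"
    "\<And>x y. x \<in> K \<Longrightarrow> y \<in> K \<Longrightarrow> col x = col y \<Longrightarrow> \<exists>g\<in>G. g x = y"
proof -
  let ?G = "BijGroup K"
  define r where "r = |Bij K|"
  have r: "Card_order r" "Field r = Bij K" "Well_order r"
    using card_of_Well_order[of "Bij K"] by (simp_all add: r_def Field_card_of card_of_card_order_on)
  have total: "h \<in> underS r h' \<or> h' \<in> underS r h \<or> h = h'" if "h \<in> Bij K" "h' \<in> Bij K" for h h'
    using r(2,3) that unfolding underS_def well_order_on_def linear_order_on_def total_on_def by blast
  have under_trans: "underS r h' \<subseteq> underS r h" if "h' \<in> underS r h" for h h'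
    using r(3) that unfolding underS_def well_order_on_def linear_order_on_def partial_order_on_def
      preorder_on_def trans_def antisym_def by blast
  have under_Bij: "underS r h \<subseteq> Bij K" for h using r(2) by (auto simp: underS_def Field_def)
  \<comment> \<open>The summand \<open>K\<close> keeps the size bound infinite at the early
    stages.\<close>
  have B_inf: "infinite (underS r h <+> K)" for h using infinite by (simp add: finite_Plus_iff)
  have B_card: "|underS r h <+> K| <o |Pow K|" if "h \<in> Bij K" for h
  proof (rule card_of_Plus_ordLess_infinite)
    have "|underS r h| <o r" using card_of_underS[OF r(1)] that r(2) by simp
    then show "|underS r h| <o |Pow K|" using card_of_Bij ordLess_ordLeq_trans unfolding r_def by blast
  qed (use infinite card_of_Pow in auto)
  define P where "P f h V \<longleftrightarrow> (h \<in> Bij K \<longrightarrow> good_group V \<and> |V| \<le>o |underS r h <+> K| \<and>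
      (\<forall>h'\<in>underS r h. f h' \<subseteq> V) \<and> settles V h)" for f :: "('a \<Rightarrow> 'a) \<Rightarrow> ('a \<Rightarrow> 'a) set" and h V
  have "\<exists>f. \<forall>h. P f h (f h)"
  proof (rule dependent_wf_choice[where R = "r - Id"])
    show "wf (r - Id)" using r(3) by (simp add: well_order_on_def)
    show "P f h V = P g h V" if "\<And>h'. (h', h) \<in> r - Id \<Longrightarrow> f h' = g h'" for f g h V
      using that unfolding P_def underS_def by simp
  next
    fix h f assume "\<And>h'. (h', h) \<in> r - Id \<Longrightarrow> P f h' (f h')"
    then have IH: "good_group (f h')" "|f h'| \<le>o |underS r h' <+> K|" "\<And>h''. h'' \<in> underS r h' \<Longrightarrow> f h'' \<subseteq> f h'"
      if "h' \<in> underS r h" for h'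
      using that under_Bij unfolding P_def underS_def by auto
    show "\<exists>V. P f h V"
    proof (cases "h \<in> Bij K")
      case h: True
      let ?B = "underS r h <+> K"
      \<comment> \<open>The trivial group makes the union a group at the first stage, which has no
        predecessors.\<close>
      define C where "C = insert {\<one>\<^bsub>?G\<^esub>} (f ` underS r h)"
      have good: "good_group (\<Union>C)"
      proof (rule good_group_chain_Union)
        show C_good: "good_group V" if "V \<in> C" for V using that IH(1) good_group_trivial by (auto simp: C_def)
        fix V W assume VW: "V \<in> C" "W \<in> C"
        consider "V = {\<one>\<^bsub>?G\<^esub>}" | "W = {\<one>\<^bsub>?G\<^esub>}"
          | h' h'' where "V = f h'" "W = f h''" "h' \<in> underS r h" "h'' \<in> underS r h"
          using VW by (auto simp: C_def)
        then show "V \<subseteq> W \<or> W \<subseteq> V"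
        proof cases
          case 3
          then show ?thesis using total[of h' h''] under_Bij IH(3) by blast
        qed (use good_groupD(3) C_good VW in auto)
      qed (simp add: C_def)
      have "|f h'| \<le>o |?B|" if "h' \<in> underS r h" for h'
        using IH(2)[OF that] card_of_mono1[of "underS r h' <+> K" ?B] under_trans[OF that] ordLeq_transitive by blast
      then have "|\<Union> (f ` underS r h)| \<le>o |?B|"
        using card_of_UNION_ordLeq_infinite[OF B_inf, of "underS r h" h f] card_of_Plus1 by blast
      then have card: "|\<Union>C| \<le>o |?B|"
        using card_of_insert_ordLeq[OF B_inf] by (simp add: C_def)
      then have "|\<Union>C| <o |Pow K|" using B_card[OF h] ordLeq_ordLess_trans by blast
      then obtain g where g: "good_group (generate ?G (insert g (\<Union>C)))" "settles (generate ?G (insert g (\<Union>C))) h"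
        using exists_settling[OF good _ h] by blast
      have "|generate ?G (insert g (\<Union>C))| \<le>o |?B|"
        by (intro Bij.card_of_generate card_of_insert_ordLeq B_inf card)
      moreover have "f h' \<subseteq> generate ?G (insert g (\<Union>C))" if "h' \<in> underS r h" for h'
        using that by (auto simp: C_def intro: generate.incl)
      ultimately have "P f h (generate ?G (insert g (\<Union>C)))" using g by (simp add: P_def)
      then show ?thesis by blast
    qed (simp add: P_def)
  qed
  then obtain f where "\<And>h. P f h (f h)" by blast
  then have f: "good_group (f h)" "\<And>h'. h' \<in> underS r h \<Longrightarrow> f h' \<subseteq> f h" "settles (f h) h"
    if "h \<in> Bij K" for h using that unfolding P_def by blast+
  define H where "H = \<Union> (f ` Bij K)"
  have good: "good_group H" unfolding H_def
  proof (rule good_group_chain_Union)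
    show "f ` Bij K \<noteq> {}" using id_Bij by blast
    show "good_group V" if "V \<in> f ` Bij K" for V using that f(1) by blast
    fix V W assume "V \<in> f ` Bij K" "W \<in> f ` Bij K"
    then obtain h h' where "V = f h" "W = f h'" "h \<in> Bij K" "h' \<in> Bij K" by blast
    then show "V \<subseteq> W \<or> W \<subseteq> V" using total[of h h'] f(2) by blast
  qed
  \<comment> \<open>A permutation \<open>h\<close> in a larger cofinitary group was already settled
    by \<open>f h\<close>, which is contained in \<open>H\<close>.\<close>
  have "maximal_cofinitary_group \<kappa> H"
    unfolding maximal_cofinitary_group_def
  proof (intro conjI notI)
    show "cofinitary_group \<kappa> H" using good by (simp add: good_group_def)
    assume "\<exists>H'. H \<subset> H' \<and> cofinitary_group \<kappa> H'"
    then obtain H' h where H': "H \<subseteq> H'" "cofinitary_group \<kappa> H'" "h \<in> H'" "h \<notin> H" by blast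
    have h: "h \<in> Bij K" using H'(2,3) subgroup.subset[of H' ?G] by (auto simp: cofinitary_group_def)
    then have "insert h (f h) \<subseteq> H'" using H'(1,3) by (auto simp: H_def)
    then have "h \<in> f h" using f(3)[OF h] H'(2) unfolding settles_def by blast
    then show False using H'(4) h by (auto simp: H_def)
  qed
  moreover have "\<exists>g\<in>H. g x = y" if xy: "x \<in> K" "y \<in> K" "col x = col y" for x y
  proof (cases "x = y")
    case True
    then show ?thesis using good_groupD(3)[OF good] BijGroup_one_app[OF xy(1)] by blast
  next
    case False
    \<comment> \<open>This transposition has finite support and respects the colours, so
      \<open>settles\<close> provides an element of \<open>f h\<close> that agrees with it at
      \<open>x\<close>.\<close>
    define h where "h = (\<lambda>t\<in>K. if t = x then y else if t = y then x else t)"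
    have h: "h \<in> Bij K" unfolding h_def by (rule transposition_Bij[OF xy(1,2)])
    have "small {t \<in> K. h t \<noteq> t}"
      by (rule small_subset[OF small_finite[of "{x, y}"]]) (auto simp: h_def)
    moreover have "\<forall>t\<in>K. col (h t) = col t" using xy by (simp add: h_def)
    ultimately obtain g where g: "g \<in> f h" "\<forall>t\<in>K. h t \<noteq> t \<longrightarrow> g t = h t"
      using f(3)[OF h] unfolding settles_def by blast
    have "h x = y" using xy(1) by (simp add: h_def)
    then have "g x = y" using g(2) xy(1) False by metis
    then show ?thesis using g(1) h by (auto simp: H_def)
  qed
  ultimately show thesis using that good by blast
qed

end

section \<open>From the partition to the colouring\<close>

theorem theorem3p9:
  fixes \<kappa> :: "'a rel"
  assumes "Card_order \<kappa>"
    and "natLeq <o \<kappa>"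
    and "regularCard \<kappa>"
    and "less_power \<kappa> =o \<kappa>"
    and "pseudointersection_number \<kappa> =o ctwo ^c \<kappa>"
  shows "\<forall>l \<in> Field \<kappa>. \<forall>P :: 'a \<Rightarrow> 'a set.
           partition_on (Field \<kappa>) (P ` underS \<kappa> l) \<longrightarrow>
           (\<exists>G. maximal_cofinitary_group \<kappa> G \<and> ORB \<kappa> G = P ` underS \<kappa> l)"
proof (intro ballI allI impI)
  fix l and P :: "'a \<Rightarrow> 'a set"
  assume l: "l \<in> Field \<kappa>" and part: "partition_on (Field \<kappa>) (P ` underS \<kappa> l)"
  let ?K = "Field \<kappa>" and ?Q = "P ` underS \<kappa> l"
  have inf: "infinite ?K"
    using assms(2) card_of_ordLeq_infinite[of "UNIV :: nat set" ?K] card_of_nat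
      card_of_Field_ordIso[OF assms(1)] infinite_UNIV_nat
    by (meson ordIso_ordLeq_trans ordIso_symmetric ordLeq_ordIso_trans ordLess_imp_ordLeq)
  interpret regular_cardinal \<kappa> using assms(1,3) inf by unfold_locales
  \<comment> \<open>The colour of a point is the block itself, so the orbits can be compared
    directly with colours.\<close>
  define col where "col x = (SOME Q. Q \<in> ?Q \<and> x \<in> Q)" for x
  have col_ex: "col x \<in> ?Q \<and> x \<in> col x" if "x \<in> ?K" for x
  proof -
    have "\<exists>Q. Q \<in> ?Q \<and> x \<in> Q" using partition_onD1[OF part] that by blast
    then show ?thesis unfolding col_def by (rule someI_ex)
  qed
  have col_eq: "col x = Q" "x \<in> ?K" if "Q \<in> ?Q" "x \<in> Q" for x Q
  proof -
    show "x \<in> ?K" using partition_onD1[OF part] that by blast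
    then show "col x = Q" using col_ex[of x] partition_onD2[OF part] that by (auto simp: disjoint_def)
  qed
  interpret coloured_cardinal \<kappa> col
  proof
    have "small ?Q" using small_image[OF card_of_underS[OF assms(1) l]] .
    moreover have "col ` ?K \<subseteq> ?Q" using col_ex by blast
    ultimately show "small (col ` ?K)" by (rule small_subset)
    fix F assume F: "F \<subseteq> Pow ?K" "strong_intersection_property \<kappa> F" "|F| <o |Pow ?K|"
    \<comment> \<open>A counterexample of size less than \<open>2^\<kappa>\<close> would bound the
      pseudointersection number.\<close>
    show "\<exists>A. is_pseudointersection \<kappa> F A"
    proof (rule ccontr)
      assume "\<nexists>A. is_pseudointersection \<kappa> F A"
      then have "no_pseudointersection_family \<kappa> F" using F(1,2) by (simp add: no_pseudointersection_family_def)
      then have "pseudointersection_number \<kappa> \<le>o |F|" by (rule pseudointersection_number_least(2))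
      then have "|Pow ?K| \<le>o |F|"
        using assms(5) card_power ordIso_symmetric ordIso_ordLeq_trans by metis
      then show False using F(3) not_ordLess_ordLeq by blast
    qed
  qed
  obtain G where G: "maximal_cofinitary_group \<kappa> G" "good_group G"
    "\<And>x y. x \<in> ?K \<Longrightarrow> y \<in> ?K \<Longrightarrow> col x = col y \<Longrightarrow> \<exists>g\<in>G. g x = y"
    using exists_maximal_transitive by blast
  have orbit: "{g x |g. g \<in> G} = col x" if x: "x \<in> ?K" for x
  proof
    show "{g x |g. g \<in> G} \<subseteq> col x"
    proof safe
      fix g assume g: "g \<in> G"
      then have "g x \<in> ?K" using good_groupD(2)[OF G(2)] Bij_app[of g ?K x] x by blast
      then show "g x \<in> col x" using col_ex[of "g x"] good_groupD(5)[OF G(2) g x] by simp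
    qed
    show "col x \<subseteq> {g x |g. g \<in> G}"
    proof
      fix y assume y: "y \<in> col x"
      then have "y \<in> ?K" "col x = col y" using col_eq[of "col x" y] col_ex[OF x] by auto
      then obtain g where "g \<in> G" "g x = y" using G(3)[OF x] by blast
      then show "y \<in> {g x |g. g \<in> G}" by blast
    qed
  qed
  have "ORB \<kappa> G = {{g x |g. g \<in> G} |x. x \<in> ?K}"
    by (simp add: ORB_def orbits_def orbit_def)
  also have "\<dots> = col ` ?K" using orbit by blast
  also have "\<dots> = ?Q"
  proof
    show "col ` ?K \<subseteq> ?Q" using col_ex by blast
    \<comment> \<open>Blocks are nonempty, so each of them is the colour of some point.\<close>
    show "?Q \<subseteq> col ` ?K"
    proof
      fix Q assume Q: "Q \<in> ?Q"
      then have "Q \<noteq> {}" using partition_onD3[OF part] by metis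
      then obtain x where "x \<in> Q" by blast
      then show "Q \<in> col ` ?K" using col_eq[OF Q] by blast
    qed
  qed
  finally show "\<exists>G. maximal_cofinitary_group \<kappa> G \<and> ORB \<kappa> G = ?Q" using G(1) by blast
qed

end
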